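(* Let $p\in[1,\infty)$, let $\Omega\subset\mathbb{R}^d$ be an open set and let $K:[0,\infty)\to[0,\infty)$ be a measurable function such that $$\int_0^\infty (x^p\wedge 1)\,K(x)\,x^{d-1}\,dx<\infty .$$ Denote $$[f]_K:=\left(\int_\Omega\int_\Omega|f(x)-f(y)|^pK(|x-y|)\,dy\,dx\right)^{1/p}$$ and consider the space $X(\Omega)=\{f\in L^p(\Omega):[f]_K<\infty\}$ with the norm $$\|f\|_{X(\Omega)}=\left(\int_\Omega|f(x)|^p\,dx+[f]_K^p\right)^{1/p}.$$ Then $C^\infty(\Omega)\cap X(\Omega)$ is dense in $(X(\Omega),\|\cdot\|_{X(\Omega)})$.
   Context: Here $a\wedge b=\min(a,b)$. *)

theory Defs
  imports "HOL-Analysis.Analysis"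
begin

text \<open>
  Functions on \<open>\<Omega>\<close> are represented by total functions whose values outside \<open>\<Omega>\<close> are irrelevant;
  functions that agree almost everywhere are not identified. Measurability is Lebesgue
  measurability. The extended-real power is only meant for positive exponents.
\<close>

definition ennreal_powr :: "ennreal \<Rightarrow> real \<Rightarrow> ennreal" where
  "ennreal_powr x a = (if x = \<infinity> then \<infinity> else ennreal (enn2real x powr a))"

definition Lp_integral :: "real \<Rightarrow> 'a::euclidean_space set \<Rightarrow> ('a \<Rightarrow> real) \<Rightarrow> ennreal" where
  "Lp_integral p \<Omega> f = (\<integral>\<^sup>+x. ennreal (\<bar>f x\<bar> powr p) \<partial>lebesgue_on \<Omega>)"

definition Lp_space :: "real \<Rightarrow> 'a::euclidean_space set \<Rightarrow> ('a \<Rightarrow> real) set" where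
  "Lp_space p \<Omega> = {f \<in> borel_measurable (lebesgue_on \<Omega>). Lp_integral p \<Omega> f < \<infinity>}"

definition K_seminorm ::
  "real \<Rightarrow> (real \<Rightarrow> real) \<Rightarrow> 'a::euclidean_space set \<Rightarrow> ('a \<Rightarrow> real) \<Rightarrow> ennreal" where
  "K_seminorm p K \<Omega> f =
     ennreal_powr
       (\<integral>\<^sup>+x. (\<integral>\<^sup>+y. ennreal (\<bar>f x - f y\<bar> powr p * K (norm (x - y))) \<partial>lebesgue_on \<Omega>)
          \<partial>lebesgue_on \<Omega>)
       (1 / p)"

definition X_space ::
  "real \<Rightarrow> (real \<Rightarrow> real) \<Rightarrow> 'a::euclidean_space set \<Rightarrow> ('a \<Rightarrow> real) set" where
  "X_space p K \<Omega> = {f \<in> Lp_space p \<Omega>. K_seminorm p K \<Omega> f < \<infinity>}"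

definition X_norm ::
  "real \<Rightarrow> (real \<Rightarrow> real) \<Rightarrow> 'a::euclidean_space set \<Rightarrow> ('a \<Rightarrow> real) \<Rightarrow> ennreal" where
  "X_norm p K \<Omega> f =
     ennreal_powr (Lp_integral p \<Omega> f + ennreal_powr (K_seminorm p K \<Omega> f) p) (1 / p)"

text \<open>
  On an open set, \<open>Ck_on k f\<close> says that \<open>f\<close> is \<open>k\<close> times continuously differentiable: all
  directional derivatives of order at most \<open>k\<close> exist and are continuous.
\<close>

primrec Ck_on :: "nat \<Rightarrow> ('a::euclidean_space \<Rightarrow> real) \<Rightarrow> 'a set \<Rightarrow> bool" where
  "Ck_on 0 f \<Omega> \<longleftrightarrow> continuous_on \<Omega> f"
| "Ck_on (Suc k) f \<Omega> \<longleftrightarrow>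
     (\<forall>x\<in>\<Omega>. f differentiable (at x)) \<and> (\<forall>v. Ck_on k (\<lambda>x. frechet_derivative f (at x) v) \<Omega>)"

definition C_infinity :: "'a::euclidean_space set \<Rightarrow> ('a \<Rightarrow> real) set" where
  "C_infinity \<Omega> = {f. \<forall>k. Ck_on k f \<Omega>}"

text \<open>
  Density with respect to an extended-real-valued norm; expressed by approximation since the norm
  does not separate functions that agree almost everywhere.
\<close>

definition dense_wrt_norm ::
  "(('a \<Rightarrow> real) \<Rightarrow> ennreal) \<Rightarrow> ('a \<Rightarrow> real) set \<Rightarrow> ('a \<Rightarrow> real) set \<Rightarrow> bool" where
  "dense_wrt_norm N D X \<longleftrightarrow>
     D \<subseteq> X \<and> (\<forall>f\<in>X. \<forall>\<epsilon>>0. \<exists>g\<in>D. N (\<lambda>x. f x - g x) < ennreal \<epsilon>)"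

end

theory Submission
  imports Defs "HOL-Probability.Probability_Measure"
begin

text \<open>
  The proof follows Meyers and Serrin. A function \<open>f\<close> of the space is cut into locally finitely many
  pieces of bounded support inside \<open>\<Omega>\<close>, each piece is mollified so little that the errors are
  summable, and the mollified pieces are added up again; the sum is smooth because near every point of
  \<open>\<Omega>\<close> only finitely many pieces are nonzero.

  Two properties of the seminorm make this work. First, multiplication with a Lipschitz cutoff
  \<open>\<phi>\<close> preserves it (\<open>energy_cutoff_finite\<close>): in
  \<open>f(y) \<phi>(y) - f(x) \<phi>(x) = \<phi>(y) (f(y) - f(x)) + f(x) (\<phi>(y) - \<phi>(x))\<close> the second term is controlled by
  \<open>\<bar>f(x)\<bar>\<^sup>p (\<bar>x - y\<bar>\<^sup>p \<and> 1) K(\<bar>x - y\<bar>)\<close>, whose integral over \<open>y\<close> is bounded by the assumption on the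
  kernel, read in polar coordinates. If \<open>\<phi>\<close> vanishes outside \<open>\<Omega>\<close>, the extension of the product by zero
  even has finite seminorm on the whole space, so that the boundary of \<open>\<Omega>\<close> disappears from the problem.

  Second, on the whole space mollification converges in the seminorm (\<open>mollification_converges\<close>). With
  \<open>y = x + h\<close> the \<open>p\<close>-th power of the seminorm is the integral over \<open>h\<close>, with weight \<open>K(\<bar>h\<bar>)\<close>, of the
  \<open>p\<close>-th powers of the \<open>L\<^sup>p\<close> norms of the differences \<open>u(x + h) - u(x)\<close>. Mollification commutes with taking differences, and by
  Jensen's inequality its error is an average of translation errors. These tend to zero for every fixed
  \<open>h\<close> by continuity of translations in \<open>L\<^sup>p\<close>, and after integration over \<open>h\<close> by dominated convergence.

  Locality and summation of the errors are combined in \<open>smooth_approximation\<close>. All estimates are carried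
  out for Borel functions on the whole space; \<open>double_integral_eq_energy\<close> transfers them to Lebesgue
  measurable functions on \<open>\<Omega>\<close> by changing functions and kernel on null sets.
\<close>

section \<open>Calculus of \<open>k\<close> times continuously differentiable functions\<close>

lemma Ck_on_continuous_on: "Ck_on k f S \<Longrightarrow> continuous_on S f"
  by (cases k)
    (auto intro!: differentiable_imp_continuous_on simp: differentiable_on_def differentiable_at_withinI)

lemma Ck_on_Suc_imp: "Ck_on (Suc k) f S \<Longrightarrow> Ck_on k f S"
proof (induction k arbitrary: f)
  case 0
  then show ?case using Ck_on_continuous_on[OF 0] by simp
qed simp

lemma Ck_on_cong_open:
  assumes "open S" "\<And>x. x \<in> S \<Longrightarrow> f x = g x" "Ck_on k f S"
  shows "Ck_on k g S"
  using assms(2,3)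
proof (induction k arbitrary: f g)
  case 0
  then show ?case by (auto cong: continuous_on_cong)
next
  case (Suc k)
  have d: "f differentiable (at x)" if "x \<in> S" for x using Suc.prems(2) that by simp
  have eq: "frechet_derivative f (at x) = frechet_derivative g (at x)" if "x \<in> S" for x
    by (rule frechet_derivative_transform_within_open[OF d[OF that] assms(1) that Suc.prems(1)])
  have "g differentiable (at x)" if "x \<in> S" for x
    using d[OF that] assms(1) that Suc.prems(1) unfolding differentiable_def
    by (metis has_derivative_transform_within_open)
  moreover have "Ck_on k (\<lambda>x. frechet_derivative g (at x) v) S" for v
    by (rule Suc.IH[of "\<lambda>x. frechet_derivative f (at x) v"])
      (use eq Suc.prems(2) in auto)
  ultimately show ?case by simp
qed

text \<open>This reduces the smoothness of a locally finite sum to that of finite sums.\<close>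

lemma Ck_on_local:
  assumes "\<And>x. x \<in> S \<Longrightarrow> \<exists>U. open U \<and> x \<in> U \<and> Ck_on k f U"
  shows "Ck_on k f S"
  using assms
proof (induction k arbitrary: f)
  case 0
  then show ?case
    by (metis Ck_on.simps(1) continuous_at_imp_continuous_on continuous_on_eq_continuous_at)
next
  case (Suc k)
  have "f differentiable (at x)" if "x \<in> S" for x
    using Suc.prems[OF that] by auto
  moreover have "Ck_on k (\<lambda>x. frechet_derivative f (at x) v) S" for v
    by (rule Suc.IH) (use Suc.prems in fastforce)
  ultimately show ?case by simp
qed

lemma Ck_on_mono: "Ck_on k f S \<Longrightarrow> T \<subseteq> S \<Longrightarrow> Ck_on k f T"
  by (induction k arbitrary: f) (auto intro: continuous_on_subset)

text \<open>A function is shown to be \<open>C\<^sup>k\<^sup>+\<^sup>1\<close> by exhibiting some derivative \<open>D\<close> and showing that \<open>D\<close>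
  is \<open>C\<^sup>k\<close> in each direction: derivatives are unique, and the choice operator in
  \<^const>\<open>frechet_derivative\<close> need not be evaluated.\<close>

lemma Ck_on_SucI:
  assumes "open S" "\<And>x. x \<in> S \<Longrightarrow> (f has_derivative D x) (at x)"
    and "\<And>v. Ck_on k (\<lambda>x. D x v) S"
  shows "Ck_on (Suc k) f S"
proof -
  have eq: "frechet_derivative f (at x) = D x" if "x \<in> S" for x
    using frechet_derivative_at[OF assms(2)[OF that]] by simp
  have "Ck_on k (\<lambda>x. frechet_derivative f (at x) v) S" for v
    by (rule Ck_on_cong_open[OF assms(1) _ assms(3)[of v]]) (simp add: eq)
  then show ?thesis using assms(2) by (auto simp: differentiable_def)
qed

lemma Ck_on_derivE:
  assumes "Ck_on (Suc k) f S" "x \<in> S"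
  shows "(f has_derivative frechet_derivative f (at x)) (at x)"
  using assms by (simp add: frechet_derivative_works)

lemma Ck_on_const: "open S \<Longrightarrow> Ck_on k (\<lambda>x. c) S"
proof (induction k arbitrary: c)
  case (Suc k)
  show ?case
    by (rule Ck_on_SucI[where D="\<lambda>x v. 0"]) (use Suc in auto)
qed auto

lemma Ck_on_add:
  assumes "open S"
  shows "Ck_on k f S \<Longrightarrow> Ck_on k g S \<Longrightarrow> Ck_on k (\<lambda>x. f x + g x) S"
proof (induction k arbitrary: f g)
  case 0
  then show ?case by (auto intro: continuous_intros)
next
  case (Suc k)
  show ?case
    by (rule Ck_on_SucI[OF assms, where D="\<lambda>x v. frechet_derivative f (at x) v + frechet_derivative g (at x) v"])
      (use Suc in \<open>auto intro!: derivative_intros simp: frechet_derivative_works\<close>)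
qed

lemma Ck_on_sum:
  assumes "open S" "\<And>i. i \<in> I \<Longrightarrow> Ck_on k (f i) S"
  shows "Ck_on k (\<lambda>x. \<Sum>i\<in>I. f i x) S"
  using assms(2)
  by (induction I rule: infinite_finite_induct)
    (auto intro: Ck_on_const[OF assms(1)] Ck_on_add[OF assms(1)])

lemma Ck_on_mult:
  assumes "open S"
  shows "Ck_on k f S \<Longrightarrow> Ck_on k g S \<Longrightarrow> Ck_on k (\<lambda>x. f x * g x) S"
proof (induction k arbitrary: f g)
  case 0
  then show ?case by (auto intro: continuous_intros)
next
  case (Suc k)
  show ?case
  proof (rule Ck_on_SucI[OF assms, where
      D="\<lambda>x v. f x * frechet_derivative g (at x) v + frechet_derivative f (at x) v * g x"])
    fix x assume "x \<in> S"
    then show "((\<lambda>x. f x * g x) has_derivative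
      (\<lambda>v. f x * frechet_derivative g (at x) v + frechet_derivative f (at x) v * g x)) (at x)"
      using Suc.prems by (intro has_derivative_mult Ck_on_derivE)
  next
    fix v
    have "Ck_on k f S" "Ck_on k g S" using Suc.prems Ck_on_Suc_imp by blast+
    then show "Ck_on k (\<lambda>x. f x * frechet_derivative g (at x) v + frechet_derivative f (at x) v * g x) S"
      using Suc.prems by (intro Ck_on_add[OF assms] Suc.IH) auto
  qed
qed

lemma Ck_on_inner: "open S \<Longrightarrow> Ck_on k (\<lambda>x. x \<bullet> v) S"
proof (cases k)
  case (Suc n)
  assume "open S"
  then show ?thesis unfolding Suc
    by (intro Ck_on_SucI[where D="\<lambda>x w. w \<bullet> v"] Ck_on_const)
      (auto intro!: derivative_eq_intros)
qed (auto intro!: continuous_intros)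

lemma Ck_on_inner_self: "open S \<Longrightarrow> Ck_on k (\<lambda>x::'a::euclidean_space. x \<bullet> x) S"
  by (subst euclidean_inner) (intro Ck_on_sum Ck_on_mult Ck_on_inner)

section \<open>Smooth bump functions\<close>

text \<open>The functions \<open>exp (- 1 / t) / t\<^sup>n\<close>, extended by zero to \<open>t \<le> 0\<close>, form a family that is
  closed under differentiation up to linear combinations. This makes the smoothness of the
  standard bump a plain induction.\<close>

definition flat_exp :: "nat \<Rightarrow> real \<Rightarrow> real" where
  "flat_exp n t = (if t \<le> 0 then 0 else exp (- 1 / t) / t ^ n)"

lemma flat_exp_tendsto_0: "((\<lambda>t. exp (- 1 / t) / t ^ n) \<longlongrightarrow> 0) (at_right (0::real))"
proof -
  have "((\<lambda>s::real. s ^ n / exp s) \<longlongrightarrow> 0) at_top" by (rule tendsto_power_div_exp_0)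
  from filterlim_compose[OF this filterlim_inverse_at_top_right]
  have "((\<lambda>t::real. inverse t ^ n / exp (inverse t)) \<longlongrightarrow> 0) (at_right 0)" .
  then show ?thesis
    by (rule Lim_transform_eventually)
      (auto simp: eventually_at_filter exp_minus field_simps power_divide)
qed

lemma flat_exp_has_real_derivative:
  "(flat_exp n has_real_derivative flat_exp (n + 2) t - real n * flat_exp (Suc n) t) (at t)"
proof -
  consider "t < 0" | "t > 0" | "t = 0" by linarith
  then show ?thesis
  proof cases
    case 1
    have "((\<lambda>t. 0) has_real_derivative 0) (at t)" by simp
    then have "(flat_exp n has_real_derivative 0) (at t)"
      by (rule has_field_derivative_transform_within_open[where S="{..<0}"])
        (use 1 in \<open>auto simp: flat_exp_def\<close>)
    then show ?thesis using 1 by (simp add: flat_exp_def)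
  next
    case 2
    have "((\<lambda>t. exp (- 1 / t)) has_real_derivative exp (- 1 / t) / t\<^sup>2) (at t)"
      using 2 by (auto intro!: derivative_eq_intros simp: power2_eq_square)
    from DERIV_divide[OF this DERIV_pow, of n] 2
    have "((\<lambda>t. exp (- 1 / t) / t ^ n) has_real_derivative
        (exp (- 1 / t) / t\<^sup>2 * t ^ n - exp (- 1 / t) * (real n * t ^ (n - Suc 0))) / (t ^ n * t ^ n)) (at t)"
      by simp
    also have "(exp (- 1 / t) / t\<^sup>2 * t ^ n - exp (- 1 / t) * (real n * t ^ (n - Suc 0))) / (t ^ n * t ^ n)
        = flat_exp (n + 2) t - real n * flat_exp (Suc n) t"
      using 2 by (cases n) (simp_all add: flat_exp_def field_simps power2_eq_square)
    finally have "((\<lambda>t. exp (- 1 / t) / t ^ n) has_real_derivative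
        flat_exp (n + 2) t - real n * flat_exp (Suc n) t) (at t)" .
    then show ?thesis
      by (rule has_field_derivative_transform_within_open[where S="{0<..}"])
        (use 2 in \<open>auto simp: flat_exp_def\<close>)
  next
    case 3
    have "(flat_exp (Suc n) \<longlongrightarrow> 0) (at_right 0)"
      by (rule Lim_transform_eventually[OF flat_exp_tendsto_0[of "Suc n"]])
        (auto simp: eventually_at_filter flat_exp_def)
    moreover have "(flat_exp (Suc n) \<longlongrightarrow> 0) (at_left 0)"
      by (rule Lim_transform_eventually[OF tendsto_const])
        (auto simp: eventually_at_filter flat_exp_def)
    ultimately have "(flat_exp (Suc n) \<longlongrightarrow> 0) (at 0)"
      by (simp add: filterlim_split_at)
    then have "((\<lambda>h. (flat_exp n (0 + h) - flat_exp n 0) / h) \<longlongrightarrow> 0) (at 0)"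
      by (rule Lim_transform_eventually) (auto simp: eventually_at_filter flat_exp_def)
    then show ?thesis using 3 by (simp add: DERIV_def flat_exp_def)
  qed
qed

text \<open>By the chain rule the derivative of \<open>flat_exp n \<circ> q\<close> is a combination of \<open>flat_exp (n + 2) \<circ> q\<close> and
  \<open>flat_exp (n + 1) \<circ> q\<close> multiplied by a derivative of \<open>q\<close>, so the induction on \<open>k\<close> has to range over all \<open>n\<close>.\<close>

lemma Ck_on_flat_exp:
  assumes "open S" "\<And>k. Ck_on k q S"
  shows "Ck_on k (\<lambda>x. flat_exp n (q x)) S"
proof (induction k arbitrary: n)
  case 0
  have "continuous_on UNIV (flat_exp n)"
    by (rule DERIV_continuous_on[OF DERIV_subset[OF flat_exp_has_real_derivative]]) auto
  then show ?case
    using continuous_on_compose2[of UNIV "flat_exp n" S q] Ck_on_continuous_on[OF assms(2)] by auto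
next
  case (Suc k)
  define D where "D \<equiv> \<lambda>x v. (flat_exp (n + 2) (q x) + (- real n) * flat_exp (Suc n) (q x)) *
    frechet_derivative q (at x) v"
  show ?case
  proof (rule Ck_on_SucI[OF assms(1), where D=D])
    fix x assume "x \<in> S"
    have "(flat_exp n has_derivative (\<lambda>h. (flat_exp (n + 2) (q x) - real n * flat_exp (Suc n) (q x)) * h))
       (at (q x))"
      using flat_exp_has_real_derivative[of n "q x"] unfolding has_field_derivative_def by simp
    from has_derivative_compose[OF Ck_on_derivE[OF assms(2) \<open>x \<in> S\<close>] this]
    show "((\<lambda>x. flat_exp n (q x)) has_derivative D x) (at x)"
      by (simp add: D_def)
  next
    fix v
    have "Ck_on k (\<lambda>x. frechet_derivative q (at x) v) S"
      using assms(2)[of "Suc k"] by simp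
    then show "Ck_on k (\<lambda>x. D x v) S" unfolding D_def
      by (intro Ck_on_mult Ck_on_add Suc.IH Ck_on_const assms(1))
  qed
qed

lemma bounded_support_continuous_integrable:
  fixes f :: "'a::euclidean_space \<Rightarrow> real"
  assumes "continuous_on UNIV f" "\<And>x. norm x \<ge> r \<Longrightarrow> f x = 0"
  shows "integrable lborel f"
proof -
  have "integrable lborel (\<lambda>x. indicator (cball 0 r) x *\<^sub>R f x)"
    by (rule borel_integrable_compact) (auto intro: continuous_on_subset[OF assms(1)])
  moreover have "(\<lambda>x. indicator (cball 0 r) x *\<^sub>R f x) = f"
    using assms(2) by (auto simp: fun_eq_iff indicator_def)
  ultimately show ?thesis by simp
qed

text \<open>A normalised multiple of \<open>exp (- 1 / (e\<^sup>2 - \<bar>x\<bar>\<^sup>2))\<close> inside the ball of radius \<open>e\<close>. It is constructed for every radius separately, which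
  avoids rescaling a fixed bump.\<close>

lemma smooth_bump_exists:
  fixes e :: real
  assumes "e > 0"
  obtains \<eta> :: "'a::euclidean_space \<Rightarrow> real"
  where "\<And>k. Ck_on k \<eta> UNIV" "\<And>x. 0 \<le> \<eta> x" "\<And>x. \<eta> (- x) = \<eta> x"
    "\<And>x. norm x \<ge> e \<Longrightarrow> \<eta> x = 0" "integrable lborel \<eta>" "integral\<^sup>L lborel \<eta> = 1"
proof -
  define \<rho> :: "'a \<Rightarrow> real" where "\<rho> = (\<lambda>x. flat_exp 0 (e\<^sup>2 + (-1) * (x \<bullet> x)))"
  have C: "Ck_on k \<rho> UNIV" for k unfolding \<rho>_def
    by (intro Ck_on_flat_exp Ck_on_add Ck_on_mult Ck_on_const Ck_on_inner_self) auto
  have pos: "0 < \<rho> x" if "norm x < e" for x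
  proof -
    have "(norm x)\<^sup>2 < e\<^sup>2" using that by (simp add: power_strict_mono)
    then show ?thesis by (simp add: \<rho>_def flat_exp_def dot_square_norm)
  qed
  have nonneg: "0 \<le> \<rho> x" for x by (simp add: \<rho>_def flat_exp_def)
  have zero: "\<rho> x = 0" if "norm x \<ge> e" for x
  proof -
    have "e\<^sup>2 \<le> (norm x)\<^sup>2" using that assms by (simp add: power_mono)
    then show ?thesis by (simp add: \<rho>_def flat_exp_def dot_square_norm)
  qed
  have int: "integrable lborel \<rho>"
    by (rule bounded_support_continuous_integrable[OF Ck_on_continuous_on[OF C[of 0]] zero])
  have "integral\<^sup>L lborel \<rho> \<noteq> 0"
  proof
    assume "integral\<^sup>L lborel \<rho> = 0"
    then have "AE x in lborel. \<rho> x = 0"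
      using integral_nonneg_eq_0_iff_AE[OF int] nonneg by auto
    then have "AE x in lborel. x \<notin> ball (0::'a) e"
      by eventually_elim (use pos in force)
    then have "emeasure lborel (ball (0::'a) e) = 0"
      by (subst (asm) AE_iff_measurable[where N="ball 0 e"]) auto
    then show False
      using assms emeasure_ball[of e "0::'a"] unit_ball_vol_pos[of "real DIM('a)"] by simp
  qed
  moreover have "integral\<^sup>L lborel \<rho> \<ge> 0" using nonneg by simp
  ultimately have I: "integral\<^sup>L lborel \<rho> > 0" by simp
  show ?thesis
  proof (rule that[of "\<lambda>x. inverse (integral\<^sup>L lborel \<rho>) * \<rho> x"])
    show "Ck_on k (\<lambda>x. inverse (integral\<^sup>L lborel \<rho>) * \<rho> x) UNIV" for k
      by (intro Ck_on_mult Ck_on_const C) auto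
    show "inverse (integral\<^sup>L lborel \<rho>) * \<rho> (- x) = inverse (integral\<^sup>L lborel \<rho>) * \<rho> x" for x
      by (simp add: \<rho>_def)
  qed (use I nonneg zero int in auto)
qed

section \<open>Convolution with a smooth kernel of bounded support\<close>

lemma bounded_support_continuous_bounded:
  fixes f :: "'a::euclidean_space \<Rightarrow> real"
  assumes "continuous_on UNIV f" "\<And>x. norm x \<ge> r \<Longrightarrow> f x = 0"
  obtains B where "0 \<le> B" "\<And>x. \<bar>f x\<bar> \<le> B"
proof -
  have "bounded (f ` cball 0 r)"
    by (intro compact_imp_bounded compact_continuous_image continuous_on_subset[OF assms(1)]) auto
  then obtain B where B: "B > 0" "\<And>x. x \<in> cball 0 r \<Longrightarrow> \<bar>f x\<bar> \<le> B"
    by (auto simp: bounded_pos)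
  have "\<bar>f x\<bar> \<le> B" for x
    using B(1) B(2)[of x] assms(2)[of x] by (cases "norm x \<le> r") auto
  then show ?thesis using that[of B] B(1) by auto
qed

lemma frechet_derivative_outside_support:
  fixes f :: "'a::euclidean_space \<Rightarrow> real"
  assumes "\<And>x. norm x \<ge> r \<Longrightarrow> f x = 0" "norm x \<ge> r + 1"
  shows "frechet_derivative f (at x) = (\<lambda>v. 0)"
proof -
  have "open (- cball (0::'a) r)" "x \<in> - cball 0 r" using assms(2) by auto
  from has_derivative_transform_within_open[OF has_derivative_const[of 0] this, of f] assms(1)
  have "(f has_derivative (\<lambda>v. 0)) (at x)" by simp
  from frechet_derivative_at[OF this] show ?thesis by simp
qed

text \<open>The partial derivatives are continuous with bounded support, hence bounded; the mean value
  inequality turns this into a Lipschitz constant.\<close>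

lemma smooth_bounded_support_derivative_bound:
  fixes f :: "'a::euclidean_space \<Rightarrow> real"
  assumes "Ck_on 1 f UNIV" "\<And>x. norm x \<ge> r \<Longrightarrow> f x = 0"
  obtains B where "0 \<le> B" "\<And>x v. \<bar>frechet_derivative f (at x) v\<bar> \<le> B * norm v"
    "\<And>x y. \<bar>f x - f y\<bar> \<le> B * norm (x - y)"
proof -
  let ?D = "\<lambda>x. frechet_derivative f (at x)"
  have D: "(f has_derivative ?D x) (at x)" for x
    using Ck_on_derivE[of 0 f UNIV x] assms(1) by simp
  have "\<exists>C\<ge>0. \<forall>x. \<bar>?D x b\<bar> \<le> C" for b
  proof -
    have "continuous_on UNIV (\<lambda>x. ?D x b)" using assms(1) by simp
    moreover have "?D x b = 0" if "norm x \<ge> r + 1" for x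
      using frechet_derivative_outside_support[of r f x] assms(2) that by simp
    ultimately show ?thesis
      using bounded_support_continuous_bounded[of "\<lambda>x. ?D x b" "r + 1" ?thesis] by blast
  qed
  then obtain C where C: "\<And>b. 0 \<le> C b" "\<And>x b. \<bar>?D x b\<bar> \<le> C b" by metis
  define B where "B = (\<Sum>b\<in>Basis. C (b::'a))"
  have B0: "0 \<le> B" by (simp add: B_def C(1) sum_nonneg)
  have DB: "\<bar>?D x v\<bar> \<le> B * norm v" for x v
  proof -
    have l: "linear (?D x)" using D[of x] has_derivative_linear by blast
    have "?D x v = ?D x (\<Sum>b\<in>Basis. (v \<bullet> b) *\<^sub>R b)" by (simp add: euclidean_representation)
    also have "\<dots> = (\<Sum>b\<in>Basis. (v \<bullet> b) * ?D x b)"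
      by (simp add: linear_sum[OF l] linear_scale[OF l])
    also have "\<bar>\<dots>\<bar> \<le> (\<Sum>b\<in>Basis. \<bar>v \<bullet> b\<bar> * \<bar>?D x b\<bar>)"
      by (rule order_trans[OF sum_abs]) (simp add: abs_mult)
    also have "\<dots> \<le> (\<Sum>b\<in>Basis. norm v * C b)"
      by (intro sum_mono mult_mono C Basis_le_norm) auto
    finally show ?thesis by (simp add: B_def sum_distrib_left mult.commute)
  qed
  have "\<bar>f x - f y\<bar> \<le> B * norm (x - y)" for x y
  proof -
    have "norm (f x - f y) \<le> B * norm (x - y)"
    proof (rule differentiable_bound[where S=UNIV and f'="?D"])
      show "onorm (?D z) \<le> B" for z
        by (rule onorm_le) (use DB in simp)
    qed (use D in auto)
    then show ?thesis by simp
  qed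
  with that B0 DB show ?thesis by blast
qed

definition conv :: "('a::euclidean_space \<Rightarrow> real) \<Rightarrow> ('a \<Rightarrow> real) \<Rightarrow> 'a \<Rightarrow> real" where
  "conv \<psi> u x = (\<integral>y. \<psi> (x - y) * u y \<partial>lborel)"

lemma integrable_bounded_mult:
  fixes f u :: "'a::euclidean_space \<Rightarrow> real"
  assumes [measurable]: "f \<in> borel_measurable borel" and "\<And>x. \<bar>f x\<bar> \<le> B" "integrable lborel u"
  shows "integrable lborel (\<lambda>x. f x * u x)"
proof (rule Bochner_Integration.integrable_bound)
  show "integrable lborel (\<lambda>x. B * u x)" using assms by auto
  have [measurable]: "u \<in> borel_measurable borel" using assms(3) by auto
  show "(\<lambda>x. f x * u x) \<in> borel_measurable lborel" by simp
  have "\<bar>f x\<bar> * \<bar>u x\<bar> \<le> \<bar>B\<bar> * \<bar>u x\<bar>" for x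
    by (intro mult_right_mono) (use assms(2)[of x] in auto)
  then show "AE x in lborel. norm (f x * u x) \<le> norm (B * u x)"
    by (simp add: abs_mult)
qed

lemma conv_integrand_integrable:
  fixes \<psi> u :: "'a::euclidean_space \<Rightarrow> real"
  assumes "continuous_on UNIV \<psi>" "\<And>x. norm x \<ge> r \<Longrightarrow> \<psi> x = 0" "integrable lborel u"
  shows "integrable lborel (\<lambda>y. \<psi> (x - y) * u y)"
proof -
  obtain B where B: "\<And>x. \<bar>\<psi> x\<bar> \<le> B"
    using bounded_support_continuous_bounded[OF assms(1,2)] by metis
  have "continuous_on UNIV (\<lambda>y. \<psi> (x - y))"
    by (rule continuous_on_compose2[OF assms(1)]) (auto intro!: continuous_intros)
  then have "(\<lambda>y. \<psi> (x - y)) \<in> borel_measurable borel" by (rule borel_measurable_continuous_onI)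
  from integrable_bounded_mult[OF this B assms(3)] show ?thesis .
qed

text \<open>The difference quotients of the kernel converge pointwise and are bounded by its Lipschitz
  constant, so differentiation under the integral sign is an instance of dominated convergence,
  with majorant a multiple of \<open>\<bar>u\<bar>\<close>.\<close>

lemma conv_has_derivative:
  fixes \<psi> u :: "'a::euclidean_space \<Rightarrow> real"
  assumes C1: "Ck_on 1 \<psi> UNIV" and supp: "\<And>x. norm x \<ge> r \<Longrightarrow> \<psi> x = 0" and u: "integrable lborel u"
  shows "(conv \<psi> u has_derivative (\<lambda>v. conv (\<lambda>x. frechet_derivative \<psi> (at x) v) u x)) (at x)"
proof -
  let ?D = "\<lambda>x. frechet_derivative \<psi> (at x)"
  have D: "(\<psi> has_derivative ?D x) (at x)" for x
    using Ck_on_derivE[of 0 \<psi> UNIV x] C1 by simp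
  have lin: "linear (?D x)" for x using D has_derivative_linear by blast
  have c\<psi>: "continuous_on UNIV \<psi>" using Ck_on_continuous_on[OF C1] .
  have cD: "continuous_on UNIV (\<lambda>x. ?D x v)" for v using C1 by simp
  note suppD = frechet_derivative_outside_support[of r \<psi>, OF supp]
  obtain B where B: "0 \<le> B" "\<And>x v. \<bar>?D x v\<bar> \<le> B * norm v" "\<And>x y. \<bar>\<psi> x - \<psi> y\<bar> \<le> B * norm (x - y)"
    using smooth_bounded_support_derivative_bound[OF C1 supp] by metis
  have int\<psi>: "integrable lborel (\<lambda>z. \<psi> (y - z) * u z)" for y
    by (rule conv_integrand_integrable[OF c\<psi> supp u])
  have intD: "integrable lborel (\<lambda>z. ?D (y - z) v * u z)" for y v
    by (rule conv_integrand_integrable[OF cD _ u, of "r + 1"]) (simp add: suppD)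
  have [measurable]: "u \<in> borel_measurable borel" using u by auto
  have bl: "bounded_linear (\<lambda>v. conv (\<lambda>x. ?D x v) u x)"
  proof (rule bounded_linear_intro[where K="B * (\<integral>z. \<bar>u z\<bar> \<partial>lborel)"])
    show "conv (\<lambda>x. ?D x (v + w)) u x = conv (\<lambda>x. ?D x v) u x + conv (\<lambda>x. ?D x w) u x" for v w
      unfolding conv_def using intD
      by (subst Bochner_Integration.integral_add[symmetric])
        (auto simp: linear_add[OF lin] distrib_right)
    show "conv (\<lambda>x. ?D x (a *\<^sub>R v)) u x = a *\<^sub>R conv (\<lambda>x. ?D x v) u x" for a v
      unfolding conv_def using intD
      by (subst Bochner_Integration.integral_scaleR_right[symmetric])
        (auto simp: linear_scale[OF lin] mult.assoc)
    show "norm (conv (\<lambda>x. ?D x v) u x) \<le> norm v * (B * (\<integral>z. \<bar>u z\<bar> \<partial>lborel))" for v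
    proof -
      have "norm (conv (\<lambda>x. ?D x v) u x) \<le> (\<integral>z. \<bar>?D (x - z) v * u z\<bar> \<partial>lborel)"
        unfolding conv_def by (rule order_trans[OF integral_norm_bound]) simp
      also have "\<dots> \<le> (\<integral>z. (B * norm v) * \<bar>u z\<bar> \<partial>lborel)"
      proof (rule integral_mono)
        show "integrable lborel (\<lambda>z. \<bar>?D (x - z) v * u z\<bar>)" using intD by (rule integrable_abs)
        show "\<bar>?D (x - z) v * u z\<bar> \<le> B * norm v * \<bar>u z\<bar>" for z
          by (simp add: abs_mult mult_right_mono B)
      qed (use u in auto)
      finally show ?thesis by (simp add: mult_ac)
    qed
  qed
  have "((\<lambda>y. norm (conv \<psi> u y - conv \<psi> u x - conv (\<lambda>w. ?D w (y - x)) u x) / norm (y - x)) \<longlongrightarrow> 0) (at x)"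
    unfolding tendsto_at_iff_sequentially comp_def
  proof (intro allI impI)
    fix X :: "nat \<Rightarrow> 'a" assume X: "\<forall>i. X i \<in> UNIV - {x}" "X \<longlonglongrightarrow> x"
    define R where "R \<equiv> \<lambda>n z. \<bar>\<psi> (X n - z) - \<psi> (x - z) - ?D (x - z) (X n - x)\<bar> / norm (X n - x)"
    have Xne: "norm (X n - x) > 0" for n using X(1) by auto
    have intR0: "integrable lborel (\<lambda>z. (\<psi> (X n - z) - \<psi> (x - z) - ?D (x - z) (X n - x)) * u z)" for n
      using int\<psi> intD by (simp add: left_diff_distrib)
    have intR: "integrable lborel (\<lambda>z. R n z * \<bar>u z\<bar>)" for n
      using integrable_divide[OF integrable_abs[OF intR0[of n]], of "norm (X n - x)"]
      by (simp add: R_def abs_mult)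
    have Rle: "R n z \<le> 2 * B" for n z
    proof -
      have "\<bar>\<psi> (X n - z) - \<psi> (x - z) - ?D (x - z) (X n - x)\<bar> \<le> 2 * B * norm (X n - x)"
        using B(3)[of "X n - z" "x - z"] B(2)[of "x - z" "X n - x"] by simp
      then show ?thesis using Xne[of n] by (simp add: R_def field_simps)
    qed
    have R0: "(\<lambda>n. R n z) \<longlonglongrightarrow> 0" for z
    proof -
      have "((\<lambda>y. norm (\<psi> y - \<psi> (x - z) - ?D (x - z) (y - (x - z))) / norm (y - (x - z))) \<longlongrightarrow> 0) (at (x - z))"
        using D[of "x - z"] has_derivative_iff_norm by blast
      then have "(\<lambda>n. norm (\<psi> (X n - z) - \<psi> (x - z) - ?D (x - z) ((X n - z) - (x - z))) /
        norm ((X n - z) - (x - z))) \<longlonglongrightarrow> 0"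
        by (rule filterlim_compose)
          (use X in \<open>auto simp: filterlim_at intro!: tendsto_intros\<close>)
      then show ?thesis by (simp add: R_def)
    qed
    have "(\<lambda>n. \<integral>z. R n z * \<bar>u z\<bar> \<partial>lborel) \<longlonglongrightarrow> (\<integral>(z::'a). 0 \<partial>lborel)"
    proof (rule integral_dominated_convergence[where w="\<lambda>z. 2 * B * \<bar>u z\<bar>"])
      show "AE z in lborel. (\<lambda>n. R n z * \<bar>u z\<bar>) \<longlonglongrightarrow> 0"
        using tendsto_mult_left_zero[OF R0] by auto
      show "AE z in lborel. norm (R n z * \<bar>u z\<bar>) \<le> 2 * B * \<bar>u z\<bar>" for n
      proof (rule AE_I2)
        fix z
        have "0 \<le> R n z" by (simp add: R_def)
        then show "norm (R n z * \<bar>u z\<bar>) \<le> 2 * B * \<bar>u z\<bar>"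
          using mult_right_mono[OF Rle[of n z], of "\<bar>u z\<bar>"] by (simp add: abs_mult)
      qed
    qed (use intR u in auto)
    moreover have "norm (conv \<psi> u (X n) - conv \<psi> u x - conv (\<lambda>w. ?D w (X n - x)) u x) / norm (X n - x)
      \<le> (\<integral>z. R n z * \<bar>u z\<bar> \<partial>lborel)" for n
    proof -
      have "conv \<psi> u (X n) - conv \<psi> u x - conv (\<lambda>w. ?D w (X n - x)) u x
        = (\<integral>z. (\<psi> (X n - z) - \<psi> (x - z) - ?D (x - z) (X n - x)) * u z \<partial>lborel)"
        unfolding conv_def using int\<psi> intD by (simp add: left_diff_distrib)
      then have "norm (conv \<psi> u (X n) - conv \<psi> u x - conv (\<lambda>w. ?D w (X n - x)) u x)
        \<le> (\<integral>z. \<bar>\<psi> (X n - z) - \<psi> (x - z) - ?D (x - z) (X n - x)\<bar> * \<bar>u z\<bar> \<partial>lborel)"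
        using integral_norm_bound[of lborel "\<lambda>z. (\<psi> (X n - z) - \<psi> (x - z) - ?D (x - z) (X n - x)) * u z"]
        by (simp add: abs_mult)
      then have "norm (conv \<psi> u (X n) - conv \<psi> u x - conv (\<lambda>w. ?D w (X n - x)) u x) / norm (X n - x)
        \<le> (\<integral>z. \<bar>\<psi> (X n - z) - \<psi> (x - z) - ?D (x - z) (X n - x)\<bar> * \<bar>u z\<bar> \<partial>lborel) / norm (X n - x)"
        by (rule divide_right_mono) simp
      also have "\<dots> = (\<integral>z. R n z * \<bar>u z\<bar> \<partial>lborel)"
        unfolding R_def by (simp flip: integral_divide_zero)
      finally show ?thesis .
    qed
    ultimately have le: "(\<lambda>n. \<integral>z. R n z * \<bar>u z\<bar> \<partial>lborel) \<longlonglongrightarrow> 0" and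
      bd: "\<And>n. norm (conv \<psi> u (X n) - conv \<psi> u x - conv (\<lambda>w. ?D w (X n - x)) u x) / norm (X n - x) \<le> (\<integral>z. R n z * \<bar>u z\<bar> \<partial>lborel)"
      by simp_all
    show "(\<lambda>n. norm (conv \<psi> u (X n) - conv \<psi> u x - conv (\<lambda>w. ?D w (X n - x)) u x) / norm (X n - x)) \<longlonglongrightarrow> 0"
      by (rule tendsto_sandwich[OF _ _ tendsto_const le]) (simp, rule always_eventually, rule allI, rule bd)
  qed
  then show ?thesis using bl by (simp add: has_derivative_iff_norm)
qed

text \<open>A directional derivative of \<open>conv \<psi> u\<close> is again a convolution, of a derivative of \<open>\<psi>\<close> with the same
  \<open>u\<close>, so the induction moves through all derivatives of the kernel.\<close>

lemma Ck_on_conv: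
  fixes \<psi> u :: "'a::euclidean_space \<Rightarrow> real"
  assumes "\<And>j. Ck_on j \<psi> UNIV" "\<And>x. norm x \<ge> r \<Longrightarrow> \<psi> x = 0" and u: "integrable lborel u"
  shows "Ck_on k (conv \<psi> u) UNIV"
  using assms(1,2)
proof (induction k arbitrary: \<psi> r)
  case 0
  have "continuous (at x) (conv \<psi> u)" for x
    using conv_has_derivative[OF 0 u] has_derivative_continuous by blast
  then show ?case by (simp add: continuous_on_eq_continuous_at)
next
  case (Suc k)
  show ?case
  proof (rule Ck_on_SucI[OF open_UNIV conv_has_derivative[OF Suc.prems u]])
    fix v
    show "Ck_on k (\<lambda>x. conv (\<lambda>x. frechet_derivative \<psi> (at x) v) u x) UNIV"
    proof (rule Suc.IH[of _ "r + 1"])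
      show "Ck_on j (\<lambda>x. frechet_derivative \<psi> (at x) v) UNIV" for j
        using Suc.prems(1)[of "Suc j"] by simp
      show "frechet_derivative \<psi> (at x) v = 0" if "norm x \<ge> r + 1" for x
        using frechet_derivative_outside_support[OF Suc.prems(2) that] by simp
    qed
  qed
qed

section \<open>Continuity of translations\<close>

lemma powr_sum3_le:
  fixes a b c p :: real
  assumes "0 \<le> a" "0 \<le> b" "0 \<le> c" "0 \<le> p"
  shows "(a + b + c) powr p \<le> 3 powr p * (a powr p + b powr p + c powr p)"
proof -
  define m where "m = max a (max b c)"
  have "(a + b + c) powr p \<le> (3 * m) powr p"
    using assms by (intro powr_mono2) (auto simp: m_def)
  also have "\<dots> = 3 powr p * m powr p" by (simp add: powr_mult)
  also have "m powr p \<le> a powr p + b powr p + c powr p"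
    by (auto simp: m_def max_def)
  finally show ?thesis by simp
qed

lemma ennreal_powr_sum3_le:
  fixes t a b c p :: real
  assumes "\<bar>t\<bar> \<le> \<bar>a\<bar> + \<bar>b\<bar> + \<bar>c\<bar>" "0 \<le> p"
  shows "ennreal (\<bar>t\<bar> powr p) \<le>
    ennreal (3 powr p) * (ennreal (\<bar>a\<bar> powr p) + ennreal (\<bar>b\<bar> powr p) + ennreal (\<bar>c\<bar> powr p))"
proof -
  have "\<bar>t\<bar> powr p \<le> (\<bar>a\<bar> + \<bar>b\<bar> + \<bar>c\<bar>) powr p" using assms by (intro powr_mono2) auto
  also have "\<dots> \<le> 3 powr p * (\<bar>a\<bar> powr p + \<bar>b\<bar> powr p + \<bar>c\<bar> powr p)"
    using assms by (intro powr_sum3_le) auto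
  finally show ?thesis by (simp flip: ennreal_plus ennreal_mult)
qed

lemma ennreal_tendsto_0I:
  fixes f :: "'b \<Rightarrow> ennreal"
  assumes "\<And>e::real. e > 0 \<Longrightarrow> \<forall>\<^sub>F n in F. f n \<le> ennreal e"
  shows "(f \<longlongrightarrow> 0) F"
proof (rule order_tendstoI)
  fix a :: ennreal assume "0 < a"
  then obtain e :: ennreal where e: "0 < e" "e < a" using dense by blast
  then have "e < top" by (meson less_le_trans top_greatest)
  then obtain r where r: "e = ennreal r" "0 \<le> r" by (cases e) auto
  then have "r > 0" using e(1) by auto
  from assms[OF this] show "\<forall>\<^sub>F n in F. f n < a"
    by eventually_elim (use e r in auto)
qed simp

lemma ennreal_tendsto_0D:
  fixes f :: "'b \<Rightarrow> ennreal" and e :: real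
  assumes "(f \<longlongrightarrow> 0) F" "e > 0"
  shows "\<forall>\<^sub>F n in F. f n \<le> ennreal e"
  using order_tendstoD(2)[OF assms(1), of "ennreal e"] assms(2)
  by (auto elim: eventually_mono)

lemma ennreal_tendsto_0_le:
  fixes f g :: "nat \<Rightarrow> ennreal"
  assumes "f \<longlonglongrightarrow> 0" "\<And>n. g n \<le> f n"
  shows "g \<longlonglongrightarrow> 0"
  by (rule tendsto_sandwich[OF _ _ tendsto_const assms(1)]) (simp_all add: assms(2))

lemma nn_integral_lborel_shift:
  fixes z :: "'a::euclidean_space"
  assumes [measurable]: "f \<in> borel_measurable borel"
  shows "(\<integral>\<^sup>+x. f (x + z) \<partial>lborel) = (\<integral>\<^sup>+x. f x \<partial>lborel)"
proof -
  have "(\<integral>\<^sup>+x. f x \<partial>lborel) = (\<integral>\<^sup>+x. f x \<partial>distr lborel borel ((+) z))"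
    by (simp add: lborel_distr_plus)
  also have "\<dots> = (\<integral>\<^sup>+x. f (z + x) \<partial>lborel)" by (rule nn_integral_distr) auto
  finally show ?thesis by (simp add: add.commute)
qed

lemma integral_lborel_shift:
  fixes z :: "'a::euclidean_space" and f :: "'a \<Rightarrow> real"
  assumes [measurable]: "f \<in> borel_measurable borel"
  shows "(\<integral>x. f (x + z) \<partial>lborel) = (\<integral>x. f x \<partial>lborel)"
proof -
  have "(\<integral>x. f x \<partial>lborel) = (\<integral>x. f x \<partial>distr lborel borel ((+) z))"
    by (simp add: lborel_distr_plus)
  also have "\<dots> = (\<integral>x. f (z + x) \<partial>lborel)" by (rule integral_distr) auto
  finally show ?thesis by (simp add: add.commute)
qed

lemma integrable_lborel_shift:
  fixes z :: "'a::euclidean_space" and f :: "'a \<Rightarrow> real"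
  assumes "integrable lborel f"
  shows "integrable lborel (\<lambda>x. f (x + z))"
proof -
  have "integrable (distr lborel borel ((+) z)) f" using assms by (simp add: lborel_distr_plus)
  from integrable_distr[OF _ this] show ?thesis by (simp add: add.commute)
qed

definition Lp_pow :: "real \<Rightarrow> ('a::euclidean_space \<Rightarrow> real) \<Rightarrow> ennreal" where
  "Lp_pow p u = (\<integral>\<^sup>+x. ennreal (\<bar>u x\<bar> powr p) \<partial>lborel)"

lemma Lp_pow_shift:
  assumes [measurable]: "u \<in> borel_measurable borel"
  shows "Lp_pow p (\<lambda>x. u (x + z)) = Lp_pow p u"
  unfolding Lp_pow_def by (rule nn_integral_lborel_shift[of "\<lambda>x. ennreal (\<bar>u x\<bar> powr p)"]) simp

lemma Lp_pow_sum3_le: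
  assumes [measurable]: "u \<in> borel_measurable borel" "v \<in> borel_measurable borel" "w \<in> borel_measurable borel"
    and "\<And>x. \<bar>t x\<bar> \<le> \<bar>u x\<bar> + \<bar>v x\<bar> + \<bar>w x\<bar>" "0 \<le> p"
  shows "Lp_pow p t \<le> ennreal (3 powr p) * (Lp_pow p u + Lp_pow p v + Lp_pow p w)"
proof -
  have "Lp_pow p t \<le> (\<integral>\<^sup>+x. ennreal (3 powr p) *
    (ennreal (\<bar>u x\<bar> powr p) + ennreal (\<bar>v x\<bar> powr p) + ennreal (\<bar>w x\<bar> powr p)) \<partial>lborel)"
    unfolding Lp_pow_def by (intro nn_integral_mono ennreal_powr_sum3_le assms)
  also have "\<dots> = ennreal (3 powr p) * (Lp_pow p u + Lp_pow p v + Lp_pow p w)"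
    unfolding Lp_pow_def by (simp add: nn_integral_cmult nn_integral_add)
  finally show ?thesis .
qed

definition translation_continuous :: "real \<Rightarrow> ('a::euclidean_space \<Rightarrow> real) \<Rightarrow> bool" where
  "translation_continuous p u \<longleftrightarrow>
     (\<forall>Z. Z \<longlonglongrightarrow> 0 \<longrightarrow> (\<lambda>n. Lp_pow p (\<lambda>x. u (x + Z n) - u x)) \<longlonglongrightarrow> 0)"

text \<open>Translation is an isometry, so continuity of translation passes to limits: approximate \<open>u\<close> by \<open>g\<close>,
  translate \<open>g\<close>, and go back.\<close>

lemma translation_continuous_closed:
  fixes u :: "'a::euclidean_space \<Rightarrow> real"
  assumes [measurable]: "u \<in> borel_measurable borel" and p: "0 \<le> p"
    and approx: "\<And>e::real. e > 0 \<Longrightarrow> \<exists>g. g \<in> borel_measurable borel \<and> translation_continuous p g \<and>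
          Lp_pow p (\<lambda>x. u x - g x) \<le> ennreal e"
  shows "translation_continuous p u"
  unfolding translation_continuous_def
proof (intro allI impI ennreal_tendsto_0I)
  fix Z :: "nat \<Rightarrow> 'a" and e :: real
  assume Z: "Z \<longlonglongrightarrow> 0" and e: "e > 0"
  define d where "d = e / (3 powr p * 3)"
  have d: "d > 0" using e by (simp add: d_def)
  from approx[OF d] obtain g where [measurable]: "g \<in> borel_measurable borel"
    and g: "translation_continuous p g" "Lp_pow p (\<lambda>x. u x - g x) \<le> ennreal d" by blast
  have "(\<lambda>n. Lp_pow p (\<lambda>x. g (x + Z n) - g x)) \<longlonglongrightarrow> 0"
    using g(1) Z unfolding translation_continuous_def by blast
  from ennreal_tendsto_0D[OF this d]
  show "\<forall>\<^sub>F n in sequentially. Lp_pow p (\<lambda>x. u (x + Z n) - u x) \<le> ennreal e"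
  proof eventually_elim
    case (elim n)
    have "Lp_pow p (\<lambda>x. u (x + Z n) - u x) \<le> ennreal (3 powr p) *
      (Lp_pow p (\<lambda>x. u (x + Z n) - g (x + Z n)) + Lp_pow p (\<lambda>x. g (x + Z n) - g x) + Lp_pow p (\<lambda>x. u x - g x))"
      by (rule Lp_pow_sum3_le) (use p in auto)
    also have "Lp_pow p (\<lambda>x. u (x + Z n) - g (x + Z n)) = Lp_pow p (\<lambda>x. u x - g x)"
      by (rule Lp_pow_shift[of "\<lambda>x. u x - g x"]) simp
    also have "ennreal (3 powr p) * (Lp_pow p (\<lambda>x. u x - g x) + Lp_pow p (\<lambda>x. g (x + Z n) - g x)
       + Lp_pow p (\<lambda>x. u x - g x)) \<le> ennreal (3 powr p) * (ennreal d + ennreal d + ennreal d)"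
      by (intro mult_left_mono add_mono g(2) elim) auto
    also have "\<dots> = ennreal e"
      using d by (simp add: d_def flip: ennreal_plus ennreal_mult)
    finally show ?case .
  qed
qed

text \<open>Squeezing \<open>A\<close> between a compact \<open>C\<close> and an open \<open>U\<close>: for a shift shorter than the distance
  from \<open>C\<close> to the complement of \<open>U\<close>, a point can only enter or leave \<open>A\<close> through \<open>U - C\<close>.\<close>

lemma translation_continuous_indicator:
  fixes A :: "'a::euclidean_space set"
  assumes A[measurable]: "A \<in> sets borel" and fin: "emeasure lborel A < \<infinity>"
  shows "translation_continuous 1 (indicator A)"
  unfolding translation_continuous_def
proof (intro allI impI ennreal_tendsto_0I)
  fix Z :: "nat \<Rightarrow> 'a" and e :: real
  assume Z: "Z \<longlonglongrightarrow> 0" and e: "e > 0"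
  define d where "d = e / 6"
  have d: "d > 0" using e by (simp add: d_def)
  have "(\<lambda>N. emeasure lborel (A - cball 0 (real N))) \<longlonglongrightarrow> emeasure lborel (\<Inter>N. A - cball 0 (real N))"
  proof (rule Lim_emeasure_decseq)
    show "emeasure lborel (A - cball 0 (real N)) \<noteq> \<infinity>" for N
      using fin emeasure_mono[of "A - cball 0 (real N)" A lborel] by (auto simp: top_unique)
  qed (auto simp: decseq_def)
  moreover have "(\<Inter>N. A - cball 0 (real N)) = {}"
    using real_arch_simple by fastforce
  ultimately have "(\<lambda>N. emeasure lborel (A - cball 0 (real N))) \<longlonglongrightarrow> 0"
    by (metis emeasure_empty)
  then obtain N where N: "emeasure lborel (A - cball 0 (real N)) \<le> ennreal d"
    using eventually_happens'[OF sequentially_bot ennreal_tendsto_0D[OF _ d]] by blast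
  obtain C where C: "closed C" "C \<subseteq> A \<inter> cball 0 (real N)" "emeasure lebesgue (A \<inter> cball 0 (real N) - C) < ennreal d"
    by (rule sets_lebesgue_inner_closed[OF _ d, of "A \<inter> cball 0 (real N)"]) auto
  obtain U where U: "open U" "A \<subseteq> U" "emeasure lebesgue (U - A) < ennreal d"
    by (rule sets_lebesgue_outer_open[OF _ d, of A]) auto
  have [measurable]: "C \<in> sets borel" "U \<in> sets borel" using C U by auto
  have "emeasure lborel (U - C) \<le> emeasure lborel ((U - A) \<union> (A - cball 0 (real N)))
      + emeasure lborel (A \<inter> cball 0 (real N) - C)"
    by (rule order_trans[OF emeasure_mono emeasure_subadditive]) (use C U in auto)
  also have "emeasure lborel ((U - A) \<union> (A - cball 0 (real N))) \<le>
     emeasure lborel (U - A) + emeasure lborel (A - cball 0 (real N))"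
    by (rule emeasure_subadditive) auto
  also have "emeasure lborel (U - A) \<le> ennreal d" using U(3) by simp
  also note N
  also have "emeasure lborel (A \<inter> cball 0 (real N) - C) \<le> ennreal d" using C(3) by simp
  finally have UC: "emeasure lborel (U - C) \<le> ennreal (3 * d)"
    using d by (simp add: add_mono flip: ennreal_plus)
  have "compact C" using C by (metis bounded_cball bounded_subset compact_eq_bounded_closed le_inf_iff)
  have "\<exists>r>0. \<forall>x\<in>C. \<forall>y\<in>- U. r \<le> dist x y"
    by (rule separate_compact_closed[OF \<open>compact C\<close>]) (use U C in auto)
  then obtain r where r: "r > 0" "\<And>x y. x \<in> C \<Longrightarrow> y \<notin> U \<Longrightarrow> dist x y \<ge> r"
    by auto
  have "\<forall>\<^sub>F n in sequentially. norm (Z n) < r"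
    using order_tendstoD(2)[OF tendsto_norm_zero[OF Z] r(1)] .
  then show "\<forall>\<^sub>F n in sequentially. Lp_pow 1 (\<lambda>x. indicator A (x + Z n) - indicator A x) \<le> ennreal e"
  proof eventually_elim
    case (elim n)
    have in_U: "x + Z n \<in> U" if "x \<in> C" for x
      using r(2)[OF that, of "x + Z n"] elim by (auto simp: dist_norm)
    have in_U': "x \<in> U" if "x + Z n \<in> C" for x
      using r(2)[OF that, of x] elim by (auto simp: dist_norm)
    have "ennreal (\<bar>indicat_real A (x + Z n) - indicator A x\<bar> powr 1) \<le> indicator (U - C) x + indicator (U - C) (x + Z n)" for x
      using in_U[of x] in_U'[of x] U(2) C(2) by (auto simp: indicator_def)
    then have "Lp_pow 1 (\<lambda>x. indicator A (x + Z n) - indicator A x) \<le>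
       (\<integral>\<^sup>+x. indicator (U - C) x + indicator (U - C) (x + Z n) \<partial>lborel)"
      unfolding Lp_pow_def by (intro nn_integral_mono)
    also have "\<dots> = emeasure lborel (U - C) + emeasure lborel (U - C)"
      by (subst nn_integral_add) (auto simp: nn_integral_lborel_shift[of "indicator (U - C)"])
    also have "\<dots> \<le> ennreal (3 * d) + ennreal (3 * d)" by (intro add_mono UC)
    also have "\<dots> = ennreal e" using d by (simp add: d_def flip: ennreal_plus)
    finally show ?case .
  qed
qed

lemma translation_continuous_L1:
  fixes u :: "'a::euclidean_space \<Rightarrow> real"
  assumes "integrable lborel u"
  shows "translation_continuous 1 u"
  using assms
proof (induction rule: integrable_induct)
  case (base A c)
  have [measurable]: "A \<in> sets borel" using base(1) by simp
  have "Lp_pow 1 (\<lambda>x. indicator A (x + z) *\<^sub>R c - indicator A x *\<^sub>R c) =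
    ennreal \<bar>c\<bar> * Lp_pow 1 (\<lambda>x. indicator A (x + z) - indicator A x)" for z
    unfolding Lp_pow_def
    by (subst nn_integral_cmult[symmetric])
      (auto intro!: nn_integral_cong simp: indicator_def)
  note eq = this
  show ?case unfolding translation_continuous_def eq
  proof (intro allI impI)
    fix Z :: "nat \<Rightarrow> 'a" assume "Z \<longlonglongrightarrow> 0"
    then have "(\<lambda>n. Lp_pow 1 (\<lambda>x. indicator A (x + Z n) - indicator A x)) \<longlonglongrightarrow> 0"
      using translation_continuous_indicator[of A] base by (simp add: translation_continuous_def)
    from ennreal_tendsto_cmult[OF _ this, of "ennreal \<bar>c\<bar>"]
    show "(\<lambda>n. ennreal \<bar>c\<bar> * Lp_pow 1 (\<lambda>x. indicator A (x + Z n) - indicator A x)) \<longlonglongrightarrow> 0"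
      by simp
  qed
next
  case (add f g)
  have [measurable]: "f \<in> borel_measurable borel" "g \<in> borel_measurable borel" using add by auto
  show ?case unfolding translation_continuous_def
  proof (intro allI impI)
    fix Z :: "nat \<Rightarrow> 'a" assume "Z \<longlonglongrightarrow> 0"
    then have lim: "(\<lambda>n. Lp_pow 1 (\<lambda>x. f (x + Z n) - f x) + Lp_pow 1 (\<lambda>x. g (x + Z n) - g x)) \<longlonglongrightarrow> 0 + 0"
      using add by (intro tendsto_add) (auto simp: translation_continuous_def)
    have "Lp_pow 1 (\<lambda>x. f (x + Z n) + g (x + Z n) - (f x + g x)) \<le>
       Lp_pow 1 (\<lambda>x. f (x + Z n) - f x) + Lp_pow 1 (\<lambda>x. g (x + Z n) - g x)" for n
      unfolding Lp_pow_def
      by (subst nn_integral_add[symmetric])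
        (auto intro!: nn_integral_mono simp flip: ennreal_plus)
    from ennreal_tendsto_0_le[OF lim[unfolded add_0] this]
    show "(\<lambda>n. Lp_pow 1 (\<lambda>x. f (x + Z n) + g (x + Z n) - (f x + g x))) \<longlonglongrightarrow> 0" .
  qed
next
  case (lim f s)
  have [measurable]: "f \<in> borel_measurable borel" "\<And>i. s i \<in> borel_measurable borel" using lim by auto
  have "(\<lambda>i. Lp_pow 1 (\<lambda>x. f x - s i x)) \<longlonglongrightarrow> 0"
  proof -
    have "(\<lambda>i. \<integral>\<^sup>+x. ennreal (norm (f x - s i x)) \<partial>lborel) \<longlonglongrightarrow> 0"
    proof (rule nn_integral_dominated_convergence_norm[where w="\<lambda>x. 2 * norm (f x)"])
      have "integrable lborel (\<lambda>x. 2 * norm (f x))" using lim by auto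
      then show "(\<integral>\<^sup>+x. ennreal (2 * norm (f x)) \<partial>lborel) < \<infinity>"
        unfolding integrable_iff_bounded by simp
    qed (use lim in auto)
    then show ?thesis by (simp add: Lp_pow_def)
  qed
  then show ?case
  proof (intro translation_continuous_closed)
    fix e :: real assume "e > 0"
    with \<open>(\<lambda>i. Lp_pow 1 (\<lambda>x. f x - s i x)) \<longlonglongrightarrow> 0\<close>
    have "\<exists>i. Lp_pow 1 (\<lambda>x. f x - s i x) \<le> ennreal e"
      by (intro eventually_happens'[OF sequentially_bot] ennreal_tendsto_0D)
    then obtain i where "Lp_pow 1 (\<lambda>x. f x - s i x) \<le> ennreal e" by blast
    then show "\<exists>g. g \<in> borel_measurable borel \<and> translation_continuous 1 g \<and> Lp_pow 1 (\<lambda>x. f x - g x) \<le> ennreal e"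
      using lim by (intro exI[of _ "s i"] conjI) auto
  qed auto
qed

text \<open>Truncating \<open>u\<close> at height \<open>M\<close> reduces to bounded functions, for which the \<open>p\<close>-th power is dominated by
  \<open>(2 M)\<^sup>p\<^sup>-\<^sup>1\<close> times the first power; integrability of \<open>u\<close> then gives the claim through the \<open>L\<^sup>1\<close> case.\<close>

lemma translation_continuous_Lp:
  fixes u :: "'a::euclidean_space \<Rightarrow> real"
  assumes u: "integrable lborel u" and p: "1 \<le> p" and fin: "Lp_pow p u < \<infinity>"
  shows "translation_continuous p u"
proof -
  have [measurable]: "u \<in> borel_measurable borel" using u by auto
  define g where "g \<equiv> \<lambda>(M::nat) x. max (- real M) (min (real M) (u x))"
  have g_meas[measurable]: "g M \<in> borel_measurable borel" for M unfolding g_def by simp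
  have "(\<lambda>M. Lp_pow p (\<lambda>x. u x - g M x)) \<longlonglongrightarrow> nn_integral lborel (\<lambda>x::'a. 0)"
    unfolding Lp_pow_def
  proof (rule nn_integral_dominated_convergence[where w="\<lambda>x. ennreal (\<bar>u x\<bar> powr p)"])
    show "AE x in lborel. ennreal (\<bar>u x - g M x\<bar> powr p) \<le> ennreal (\<bar>u x\<bar> powr p)" for M
      using p by (intro AE_I2 ennreal_leI powr_mono2) (auto simp: g_def)
    show "AE x in lborel. (\<lambda>M. ennreal (\<bar>u x - g M x\<bar> powr p)) \<longlonglongrightarrow> 0"
    proof (intro AE_I2 tendsto_eventually)
      fix x
      obtain N :: nat where "\<bar>u x\<bar> \<le> real N" using real_arch_simple by blast
      then have "ennreal (\<bar>u x - g M x\<bar> powr p) = 0" if "M \<ge> N" for M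
        using that by (simp add: g_def)
      then show "\<forall>\<^sub>F M in sequentially. ennreal (\<bar>u x - g M x\<bar> powr p) = 0"
        by (auto simp: eventually_sequentially)
    qed
  qed (use fin in \<open>auto simp: Lp_pow_def\<close>)
  then have lim: "(\<lambda>M. Lp_pow p (\<lambda>x. u x - g M x)) \<longlonglongrightarrow> 0" by simp
  have tc: "translation_continuous p (g M)" for M
    unfolding translation_continuous_def
  proof (intro allI impI)
    fix Z :: "nat \<Rightarrow> 'a" assume Z: "Z \<longlonglongrightarrow> 0"
    have "integrable lborel (g M)"
      by (rule Bochner_Integration.integrable_bound[OF u]) (auto simp: g_def)
    then have "(\<lambda>n. Lp_pow 1 (\<lambda>x. g M (x + Z n) - g M x)) \<longlonglongrightarrow> 0"
      using translation_continuous_L1 Z unfolding translation_continuous_def by blast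
    then have l: "(\<lambda>n. ennreal ((2 * real M) powr (p - 1)) * Lp_pow 1 (\<lambda>x. g M (x + Z n) - g M x)) \<longlonglongrightarrow> 0"
      using ennreal_tendsto_cmult[of "ennreal ((2 * real M) powr (p - 1))" _ 0] by simp
    have "Lp_pow p (\<lambda>x. g M (x + Z n) - g M x)
      \<le> ennreal ((2 * real M) powr (p - 1)) * Lp_pow 1 (\<lambda>x. g M (x + Z n) - g M x)" for n
    proof -
      have "t powr p \<le> (2 * real M) powr (p - 1) * t powr 1" if "0 \<le> t" "t \<le> 2 * real M" for t
      proof -
        have "t powr p = t powr (p - 1) * t powr 1" by (subst powr_add[symmetric]) simp
        also have "\<dots> \<le> (2 * real M) powr (p - 1) * t powr 1"
          using that p by (intro mult_right_mono powr_mono2) auto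
        finally show ?thesis .
      qed
      then have "\<bar>g M (x + Z n) - g M x\<bar> powr p \<le> (2 * real M) powr (p - 1) * \<bar>g M (x + Z n) - g M x\<bar> powr 1" for x
        by (auto simp: g_def)
      then have "ennreal (\<bar>g M (x + Z n) - g M x\<bar> powr p)
         \<le> ennreal ((2 * real M) powr (p - 1)) * ennreal (\<bar>g M (x + Z n) - g M x\<bar> powr 1)" for x
        by (metis ennreal_leI ennreal_mult powr_ge_zero)
      then show ?thesis unfolding Lp_pow_def
        by (subst nn_integral_cmult[symmetric]) (auto intro!: nn_integral_mono)
    qed
    from ennreal_tendsto_0_le[OF l this]
    show "(\<lambda>n. Lp_pow p (\<lambda>x. g M (x + Z n) - g M x)) \<longlonglongrightarrow> 0" .
  qed
  show ?thesis
  proof (rule translation_continuous_closed)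
    fix e :: real assume "e > 0"
    from eventually_happens'[OF sequentially_bot ennreal_tendsto_0D[OF lim this]]
    show "\<exists>g. g \<in> borel_measurable borel \<and> translation_continuous p g \<and> Lp_pow p (\<lambda>x. u x - g x) \<le> ennreal e"
      using tc g_meas by blast
  qed (use p in auto)
qed

section \<open>Mollification\<close>

lemma convex_on_abs_powr:
  assumes "1 \<le> p"
  shows "convex_on UNIV (\<lambda>x::real. \<bar>x\<bar> powr p)"
proof (rule convex_onI)
  fix t x y :: real assume t: "0 < t" "t < 1"
  have conv: "((1 - t) * a + t * b) powr p \<le> (1 - t) * a powr p + t * b powr p" if ab: "0 \<le> a" "0 \<le> b" for a b
  proof -
    have le: "s powr p \<le> s" if "0 < s" "s < 1" for s :: real
      using powr_mono'[of 1 p s] assms that by simp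
    consider "a = 0" | "b = 0" | "a > 0" "b > 0" using ab by linarith
    then show ?thesis
    proof cases
      case 1
      then show ?thesis using t le[of t] ab by (simp add: powr_mult mult_right_mono)
    next
      case 2
      then show ?thesis using t le[of "1 - t"] ab by (simp add: powr_mult mult_right_mono)
    next
      case 3
      then show ?thesis using convex_onD[OF powr_convex[OF assms], of t a b] t by simp
    qed
  qed
  have "\<bar>(1 - t) *\<^sub>R x + t *\<^sub>R y\<bar> \<le> (1 - t) * \<bar>x\<bar> + t * \<bar>y\<bar>"
    using t abs_triangle_ineq[of "(1 - t) * x" "t * y"] by (simp add: abs_mult)
  then have "\<bar>(1 - t) *\<^sub>R x + t *\<^sub>R y\<bar> powr p \<le> ((1 - t) * \<bar>x\<bar> + t * \<bar>y\<bar>) powr p"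
    using assms by (intro powr_mono2) auto
  also have "\<dots> \<le> (1 - t) * \<bar>x\<bar> powr p + t * \<bar>y\<bar> powr p" by (rule conv) auto
  finally show "\<bar>(1 - t) *\<^sub>R x + t *\<^sub>R y\<bar> powr p \<le> (1 - t) * \<bar>x\<bar> powr p + t * \<bar>y\<bar> powr p" .
qed simp

text \<open>Jensen's inequality for the probability measure with density \<open>\<eta>\<close>.\<close>

lemma jensen_powr:
  fixes \<eta> w :: "'a::euclidean_space \<Rightarrow> real"
  assumes \<eta>: "\<And>z. 0 \<le> \<eta> z" "integrable lborel \<eta>" "integral\<^sup>L lborel \<eta> = 1"
    and [measurable]: "w \<in> borel_measurable borel" and int: "integrable lborel (\<lambda>z. \<eta> z * w z)"
    and p: "1 \<le> p"
  shows "ennreal (\<bar>\<integral>z. \<eta> z * w z \<partial>lborel\<bar> powr p) \<le> (\<integral>\<^sup>+z. ennreal (\<eta> z) * ennreal (\<bar>w z\<bar> powr p) \<partial>lborel)"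
proof (cases "(\<integral>\<^sup>+z. ennreal (\<eta> z) * ennreal (\<bar>w z\<bar> powr p) \<partial>lborel) = \<infinity>")
  case False
  have [measurable]: "\<eta> \<in> borel_measurable borel" using \<eta>(2) by auto
  define M where "M = density lborel (\<lambda>z. ennreal (\<eta> z))"
  have [measurable_cong]: "sets M = sets borel" by (simp add: M_def)
  interpret prob_space M
  proof
    have "(\<integral>\<^sup>+z. ennreal (\<eta> z) \<partial>lborel) = 1"
      using nn_integral_eq_integral[OF \<eta>(2)] \<eta>(1,3) by simp
    then show "emeasure M (space M) = 1" by (simp add: M_def emeasure_density)
  qed
  have X: "integrable M w"
    unfolding M_def using int \<eta>(1) by (subst integrable_real_density) auto
  have E: "expectation w = (\<integral>z. \<eta> z * w z \<partial>lborel)"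
    unfolding M_def using \<eta>(1) by (subst integral_real_density) auto
  have nn: "(\<integral>\<^sup>+z. ennreal (\<bar>w z\<bar> powr p) \<partial>M) = (\<integral>\<^sup>+z. ennreal (\<eta> z) * ennreal (\<bar>w z\<bar> powr p) \<partial>lborel)"
    unfolding M_def by (subst nn_integral_density) auto
  have q: "integrable M (\<lambda>z. \<bar>w z\<bar> powr p)"
    by (rule integrableI_bounded) (use nn False in \<open>auto simp: less_top\<close>)
  have "\<bar>expectation w\<bar> powr p \<le> expectation (\<lambda>z. \<bar>w z\<bar> powr p)"
    by (rule jensens_inequality[where I=UNIV, OF X _ _ q convex_on_abs_powr[OF p]]) auto
  then have "ennreal (\<bar>expectation w\<bar> powr p) \<le> (\<integral>\<^sup>+z. ennreal (\<bar>w z\<bar> powr p) \<partial>M)"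
    using nn_integral_eq_integral[OF q] by (simp add: ennreal_leI)
  then show ?thesis by (simp add: E nn)
qed simp

text \<open>For an even kernel this is the convolution with \<open>\<eta>\<close>. It is written as an average of translates
  because errors of mollification are then averages of errors of translation.\<close>

definition moll :: "('a::euclidean_space \<Rightarrow> real) \<Rightarrow> ('a \<Rightarrow> real) \<Rightarrow> 'a \<Rightarrow> real" where
  "moll \<eta> u x = (\<integral>z. \<eta> z * u (x + z) \<partial>lborel)"

text \<open>The pairs \<open>(x, y)\<close> of the double integral are written as \<open>(x, x + h)\<close>. In these coordinates
  the \<open>p\<close>-th power of the seminorm is a weighted superposition of \<open>p\<close>-th powers of \<open>L\<^sup>p\<close> norms of
  the differences \<open>u (x + h) - u x\<close>, and taking differences commutes with convolution.\<close>

definition energy :: "real \<Rightarrow> ('a::euclidean_space \<Rightarrow> real) \<Rightarrow> 'a set \<Rightarrow> ('a \<Rightarrow> real) \<Rightarrow> ennreal" where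
  "energy p k A u = (\<integral>\<^sup>+h. ennreal (k h) *
     (\<integral>\<^sup>+x. ennreal (\<bar>u (x + h) - u x\<bar> powr p) * indicator A x * indicator A (x + h) \<partial>lborel) \<partial>lborel)"

lemma energy_UNIV: "energy p k UNIV u = (\<integral>\<^sup>+h. ennreal (k h) * Lp_pow p (\<lambda>x. u (x + h) - u x) \<partial>lborel)"
  by (simp add: energy_def Lp_pow_def)

context
  fixes \<eta> :: "'a::euclidean_space \<Rightarrow> real"
  assumes \<eta>: "\<And>z. 0 \<le> \<eta> z" "integrable lborel \<eta>" "integral\<^sup>L lborel \<eta> = 1"
    and bdd: "\<exists>B. \<forall>z. \<bar>\<eta> z\<bar> \<le> B"
begin

lemma moll_integrand_integrable:
  assumes "integrable lborel v"
  shows "integrable lborel (\<lambda>z. \<eta> z * v (x + z))"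
proof -
  obtain B where "\<And>z. \<bar>\<eta> z\<bar> \<le> B" using bdd by blast
  moreover have "integrable lborel (\<lambda>z. v (x + z))"
    using integrable_lborel_shift[OF assms, of x] by (simp add: add.commute)
  moreover have "\<eta> \<in> borel_measurable borel" using \<eta>(2) by auto
  ultimately show ?thesis by (rule integrable_bounded_mult[rotated])
qed

lemma moll_diff:
  assumes "integrable lborel v" "integrable lborel w"
  shows "moll \<eta> (\<lambda>x. v x - w x) x = moll \<eta> v x - moll \<eta> w x"
  unfolding moll_def using moll_integrand_integrable[OF assms(1)] moll_integrand_integrable[OF assms(2)]
  by (simp add: right_diff_distrib)

lemma moll_shift: "moll \<eta> (\<lambda>x. v (x + h)) x = moll \<eta> v (x + h)"
  by (simp add: moll_def add_ac)

lemma Lp_pow_moll_diff_le: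
  assumes v: "integrable lborel v" and p: "1 \<le> p"
  shows "Lp_pow p (\<lambda>x. moll \<eta> v x - v x) \<le>
    (\<integral>\<^sup>+z. ennreal (\<eta> z) * Lp_pow p (\<lambda>x. v (x + z) - v x) \<partial>lborel)"
proof -
  have [measurable]: "v \<in> borel_measurable borel" "\<eta> \<in> borel_measurable borel"
    using v \<eta>(2) by auto
  have "ennreal (\<bar>moll \<eta> v x - v x\<bar> powr p) \<le>
     (\<integral>\<^sup>+z. ennreal (\<eta> z) * ennreal (\<bar>v (x + z) - v x\<bar> powr p) \<partial>lborel)" for x
  proof -
    have i: "integrable lborel (\<lambda>z. \<eta> z * v (x + z))" "integrable lborel (\<lambda>z. \<eta> z * v x)"
      using moll_integrand_integrable[OF v] \<eta>(2) by auto
    have "moll \<eta> v x - v x = (\<integral>z. \<eta> z * (v (x + z) - v x) \<partial>lborel)"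
      using i \<eta>(3) by (simp add: moll_def right_diff_distrib)
    moreover have "integrable lborel (\<lambda>z. \<eta> z * (v (x + z) - v x))"
      using i by (simp add: right_diff_distrib)
    ultimately show ?thesis
      using jensen_powr[OF \<eta>, of "\<lambda>z. v (x + z) - v x" p] p by simp
  qed
  then have "Lp_pow p (\<lambda>x. moll \<eta> v x - v x) \<le>
     (\<integral>\<^sup>+x. \<integral>\<^sup>+z. ennreal (\<eta> z) * ennreal (\<bar>v (x + z) - v x\<bar> powr p) \<partial>lborel \<partial>lborel)"
    unfolding Lp_pow_def by (intro nn_integral_mono)
  also have "\<dots> = (\<integral>\<^sup>+z. \<integral>\<^sup>+x. ennreal (\<eta> z) * ennreal (\<bar>v (x + z) - v x\<bar> powr p) \<partial>lborel \<partial>lborel)"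
    by (rule lborel_pair.Fubini') simp
  also have "\<dots> = (\<integral>\<^sup>+z. ennreal (\<eta> z) * Lp_pow p (\<lambda>x. v (x + z) - v x) \<partial>lborel)"
    unfolding Lp_pow_def by (simp add: nn_integral_cmult)
  finally show ?thesis .
qed

text \<open>For each \<open>h\<close> the \<open>L\<^sup>p\<close> estimate is applied to the difference \<open>v (x + h) - v x\<close>, whose mollification is
  the difference of the mollified function.\<close>

lemma energy_moll_diff_le:
  assumes v: "integrable lborel v" and p: "1 \<le> p" and [measurable]: "k \<in> borel_measurable borel"
  shows "energy p k UNIV (\<lambda>x. moll \<eta> v x - v x) \<le>
    (\<integral>\<^sup>+z. ennreal (\<eta> z) * energy p k UNIV (\<lambda>x. v (x + z) - v x) \<partial>lborel)"
proof -
  have [measurable]: "v \<in> borel_measurable borel" "\<eta> \<in> borel_measurable borel"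
    using v \<eta>(2) by auto
  have "Lp_pow p (\<lambda>x. (moll \<eta> v (x + h) - v (x + h)) - (moll \<eta> v x - v x)) \<le>
     (\<integral>\<^sup>+z. ennreal (\<eta> z) * Lp_pow p (\<lambda>x. (v (x + h + z) - v (x + h)) - (v (x + z) - v x)) \<partial>lborel)" for h
  proof -
    have i: "integrable lborel (\<lambda>x. v (x + h))" using integrable_lborel_shift[OF v] .
    then have "integrable lborel (\<lambda>x. v (x + h) - v x)" using v by simp
    from Lp_pow_moll_diff_le[OF this p] show ?thesis
      by (simp add: moll_diff[OF i v] moll_shift algebra_simps)
  qed
  then have "energy p k UNIV (\<lambda>x. moll \<eta> v x - v x) \<le> (\<integral>\<^sup>+h. ennreal (k h) *
     (\<integral>\<^sup>+z. ennreal (\<eta> z) * Lp_pow p (\<lambda>x. (v (x + h + z) - v (x + h)) - (v (x + z) - v x)) \<partial>lborel) \<partial>lborel)"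
    unfolding energy_UNIV by (intro nn_integral_mono mult_left_mono) auto
  also have "\<dots> = (\<integral>\<^sup>+h. \<integral>\<^sup>+z. ennreal (k h) *
     (ennreal (\<eta> z) * Lp_pow p (\<lambda>x. (v (x + h + z) - v (x + h)) - (v (x + z) - v x))) \<partial>lborel \<partial>lborel)"
    unfolding Lp_pow_def by (intro nn_integral_cong nn_integral_cmult[symmetric]) simp
  also have "\<dots> = (\<integral>\<^sup>+z. \<integral>\<^sup>+h. ennreal (k h) *
     (ennreal (\<eta> z) * Lp_pow p (\<lambda>x. (v (x + h + z) - v (x + h)) - (v (x + z) - v x))) \<partial>lborel \<partial>lborel)"
    unfolding Lp_pow_def by (rule lborel_pair.Fubini') simp
  also have "\<dots> = (\<integral>\<^sup>+z. ennreal (\<eta> z) * energy p k UNIV (\<lambda>x. v (x + z) - v x) \<partial>lborel)"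
    unfolding energy_UNIV
  proof (intro nn_integral_cong)
    fix z
    have "(\<integral>\<^sup>+h. ennreal (k h) *
       (ennreal (\<eta> z) * Lp_pow p (\<lambda>x. (v (x + h + z) - v (x + h)) - (v (x + z) - v x))) \<partial>lborel) =
      (\<integral>\<^sup>+h. ennreal (\<eta> z) *
       (ennreal (k h) * Lp_pow p (\<lambda>x. (v (x + h + z) - v (x + h)) - (v (x + z) - v x))) \<partial>lborel)"
      by (simp add: mult_ac)
    also have "\<dots> = ennreal (\<eta> z) * (\<integral>\<^sup>+h. ennreal (k h) *
       Lp_pow p (\<lambda>x. (v (x + h + z) - v (x + h)) - (v (x + z) - v x)) \<partial>lborel)"
      unfolding Lp_pow_def by (rule nn_integral_cmult) simp
    finally show "(\<integral>\<^sup>+h. ennreal (k h) *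
       (ennreal (\<eta> z) * Lp_pow p (\<lambda>x. (v (x + h + z) - v (x + h)) - (v (x + z) - v x))) \<partial>lborel) =
      ennreal (\<eta> z) * (\<integral>\<^sup>+h. ennreal (k h) *
       Lp_pow p (\<lambda>x. (v (x + h + z) - v (x + h)) - (v (x + z) - v x)) \<partial>lborel)" .
  qed
  finally show ?thesis .
qed

end

text \<open>For each \<open>h\<close> this is continuity of translation in \<open>L\<^sup>p\<close>, applied to the difference with step \<open>h\<close>.
  Finite energy of \<open>u\<close> supplies the majorant for dominated convergence in \<open>h\<close>.\<close>

lemma energy_translation_tendsto_0:
  fixes u :: "'a::euclidean_space \<Rightarrow> real"
  assumes u: "integrable lborel u" and p: "1 \<le> p" and [measurable]: "k \<in> borel_measurable borel"
    and fin: "energy p k UNIV u < \<infinity>" and Z: "Z \<longlonglongrightarrow> 0"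
  shows "(\<lambda>n. energy p k UNIV (\<lambda>x. u (x + Z n) - u x)) \<longlonglongrightarrow> 0"
proof -
  have [measurable]: "u \<in> borel_measurable borel" using u by auto
  let ?d = "\<lambda>h x. u (x + h) - u x"
  let ?w = "\<lambda>h. ennreal (k h) * (ennreal (3 powr p) * (2 * Lp_pow p (?d h)))"
  have int: "integrable lborel (?d h)" for h
    using integrable_lborel_shift[OF u] u by simp
  have le: "Lp_pow p (\<lambda>x. ?d h (x + z) - ?d h x) \<le> ennreal (3 powr p) * (2 * Lp_pow p (?d h))" for h z
  proof -
    have "Lp_pow p (\<lambda>x. ?d h (x + z) - ?d h x) \<le>
      ennreal (3 powr p) * (Lp_pow p (\<lambda>x. ?d h (x + z)) + Lp_pow p (?d h) + Lp_pow p (\<lambda>x::'a. 0))"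
      by (rule Lp_pow_sum3_le) (use p in auto)
    also have "Lp_pow p (\<lambda>x. ?d h (x + z)) = Lp_pow p (?d h)"
      by (rule Lp_pow_shift[of "?d h"]) simp
    also have "Lp_pow p (\<lambda>x::'a. 0) = 0" by (simp add: Lp_pow_def)
    finally show ?thesis by (simp add: mult_2)
  qed
  have "(\<lambda>n. \<integral>\<^sup>+h. ennreal (k h) * Lp_pow p (\<lambda>x. ?d h (x + Z n) - ?d h x) \<partial>lborel) \<longlonglongrightarrow>
     nn_integral lborel (\<lambda>h::'a. 0)"
  proof (rule nn_integral_dominated_convergence[where w="?w"])
    show "(\<lambda>h. ennreal (k h) * Lp_pow p (\<lambda>x. ?d h (x + Z n) - ?d h x)) \<in> borel_measurable lborel" for n
      unfolding Lp_pow_def by simp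
    show "?w \<in> borel_measurable lborel" unfolding Lp_pow_def by simp
    show "AE h in lborel. ennreal (k h) * Lp_pow p (\<lambda>x. ?d h (x + Z n) - ?d h x) \<le> ?w h" for n
      by (intro AE_I2 mult_left_mono le) simp
    have m: "(\<lambda>h. ennreal (k h) * Lp_pow p (?d h)) \<in> borel_measurable lborel"
      unfolding Lp_pow_def by simp
    have "(\<integral>\<^sup>+h. ?w h \<partial>lborel) = (\<integral>\<^sup>+h. (ennreal (3 powr p) * 2) * (ennreal (k h) * Lp_pow p (?d h)) \<partial>lborel)"
      by (simp add: mult_ac)
    also have "\<dots> = (ennreal (3 powr p) * 2) * energy p k UNIV u"
      unfolding energy_UNIV using m by (rule nn_integral_cmult)
    also have "\<dots> < \<infinity>" using fin by (simp add: ennreal_mult_less_top)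
    finally show "(\<integral>\<^sup>+h. ?w h \<partial>lborel) < \<infinity>" .
    have "AE h in lborel. ennreal (k h) * Lp_pow p (?d h) \<noteq> \<infinity>"
      using fin m unfolding energy_UNIV by (intro nn_integral_PInf_AE) auto
    then show "AE h in lborel. (\<lambda>n. ennreal (k h) * Lp_pow p (\<lambda>x. ?d h (x + Z n) - ?d h x)) \<longlonglongrightarrow> 0"
    proof eventually_elim
      case (elim h)
      show ?case
      proof (cases "ennreal (k h) = 0")
        case False
        with elim have "Lp_pow p (?d h) < \<infinity>" by (auto simp: ennreal_mult_eq_top_iff less_top)
        from translation_continuous_Lp[OF int p this]
        have "(\<lambda>n. Lp_pow p (\<lambda>x. ?d h (x + Z n) - ?d h x)) \<longlonglongrightarrow> 0"
          using Z unfolding translation_continuous_def by blast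
        from ennreal_tendsto_cmult[OF _ this, of "ennreal (k h)"] show ?thesis by simp
      qed simp
    qed
  qed auto
  then show ?thesis unfolding energy_UNIV by (simp add: algebra_simps)
qed

text \<open>The errors are averages, with weight \<open>\<eta>\<close>, of the translation errors \<open>S z\<close>, which are small for small
  \<open>z\<close>. Hence the estimate is uniform over all mollifiers concentrated in a small enough ball.\<close>

lemma mollification_converges:
  fixes u :: "'a::euclidean_space \<Rightarrow> real" and e :: real
  assumes u: "integrable lborel u" and p: "1 \<le> p" and k: "k \<in> borel_measurable borel"
    and fin: "Lp_pow p u < \<infinity>" "energy p k UNIV u < \<infinity>" and e: "0 < e"
  obtains d where "0 < d" "\<And>\<eta>. \<lbrakk>\<And>z. 0 \<le> \<eta> z; integrable lborel \<eta>; integral\<^sup>L lborel \<eta> = 1;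
      \<exists>B. \<forall>z. \<bar>\<eta> z\<bar> \<le> B; \<And>z. norm z \<ge> d \<Longrightarrow> \<eta> z = 0\<rbrakk> \<Longrightarrow>
    Lp_pow p (\<lambda>x. moll \<eta> u x - u x) + energy p k UNIV (\<lambda>x. moll \<eta> u x - u x) \<le> ennreal e"
proof -
  have [measurable]: "u \<in> borel_measurable borel" "k \<in> borel_measurable borel" using u k by auto
  define S where "S z = Lp_pow p (\<lambda>x. u (x + z) - u x) + energy p k UNIV (\<lambda>x. u (x + z) - u x)" for z
  have "\<exists>d>0. \<forall>z. norm z < d \<longrightarrow> S z \<le> ennreal e"
  proof (rule ccontr)
    assume neg: "\<not> (\<exists>d>0. \<forall>z. norm z < d \<longrightarrow> S z \<le> ennreal e)"
    have "\<exists>z. norm z < inverse (real (Suc n)) \<and> \<not> S z \<le> ennreal e" for n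
      using neg by (metis inverse_positive_iff_positive of_nat_0_less_iff zero_less_Suc)
    then obtain Z where Z: "\<And>n. norm (Z n) < inverse (real (Suc n))" "\<And>n. \<not> S (Z n) \<le> ennreal e"
      by metis
    have "Z \<longlonglongrightarrow> 0"
      by (rule Lim_null_comparison[OF _ LIMSEQ_inverse_real_of_nat])
        (use Z(1) in \<open>auto intro!: always_eventually less_imp_le\<close>)
    then have "(\<lambda>n. Lp_pow p (\<lambda>x. u (x + Z n) - u x)) \<longlonglongrightarrow> 0"
      using translation_continuous_Lp[OF u p fin(1)] unfolding translation_continuous_def by blast
    from tendsto_add[OF this energy_translation_tendsto_0[OF u p k fin(2) \<open>Z \<longlonglongrightarrow> 0\<close>]]
    have "(\<lambda>n. S (Z n)) \<longlonglongrightarrow> 0" by (simp add: S_def)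
    from eventually_happens'[OF sequentially_bot ennreal_tendsto_0D[OF this e]] Z(2)
    show False by blast
  qed
  then obtain d where d: "d > 0" "\<And>z. norm z < d \<Longrightarrow> S z \<le> ennreal e" by blast
  show ?thesis
  proof (rule that[OF d(1)])
    fix \<eta> :: "'a \<Rightarrow> real"
    assume \<eta>: "\<And>z. 0 \<le> \<eta> z" "integrable lborel \<eta>" "integral\<^sup>L lborel \<eta> = 1"
      and B: "\<exists>B. \<forall>z. \<bar>\<eta> z\<bar> \<le> B" and supp: "\<And>z. norm z \<ge> d \<Longrightarrow> \<eta> z = 0"
    have [measurable]: "\<eta> \<in> borel_measurable borel" using \<eta>(2) by auto
    have "Lp_pow p (\<lambda>x. moll \<eta> u x - u x) + energy p k UNIV (\<lambda>x. moll \<eta> u x - u x) \<le>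
      (\<integral>\<^sup>+z. ennreal (\<eta> z) * Lp_pow p (\<lambda>x. u (x + z) - u x) \<partial>lborel) +
      (\<integral>\<^sup>+z. ennreal (\<eta> z) * energy p k UNIV (\<lambda>x. u (x + z) - u x) \<partial>lborel)"
      by (intro add_mono Lp_pow_moll_diff_le[OF \<eta> B] energy_moll_diff_le[OF \<eta> B] u p k)
    also have "\<dots> = (\<integral>\<^sup>+z. ennreal (\<eta> z) * S z \<partial>lborel)"
      unfolding S_def Lp_pow_def energy_def
      by (subst nn_integral_add[symmetric]) (auto simp: distrib_left)
    also have "\<dots> \<le> (\<integral>\<^sup>+z. ennreal (\<eta> z) * ennreal e \<partial>lborel)"
    proof (rule nn_integral_mono)
      fix z show "ennreal (\<eta> z) * S z \<le> ennreal (\<eta> z) * ennreal e"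
        using d(2)[of z] supp[of z] by (cases "norm z < d") (auto intro: mult_left_mono)
    qed
    also have "\<dots> = (\<integral>\<^sup>+z. ennreal (\<eta> z) \<partial>lborel) * ennreal e"
      by (rule nn_integral_multc) simp
    also have "\<dots> = ennreal e"
      using nn_integral_eq_integral[OF \<eta>(2)] \<eta>(1,3) by simp
    finally show "Lp_pow p (\<lambda>x. moll \<eta> u x - u x) + energy p k UNIV (\<lambda>x. moll \<eta> u x - u x) \<le> ennreal e" .
  qed
qed

lemma moll_eq_conv:
  fixes \<eta> u :: "'a::euclidean_space \<Rightarrow> real"
  assumes [measurable]: "\<eta> \<in> borel_measurable borel" "u \<in> borel_measurable borel"
    and even: "\<And>z. \<eta> (- z) = \<eta> z"
  shows "moll \<eta> u = conv \<eta> u"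
proof
  fix x
  have "conv \<eta> u x = (\<integral>z. \<eta> (x - (z + x)) * u (z + x) \<partial>lborel)"
    unfolding conv_def by (rule integral_lborel_shift[symmetric]) simp
  then show "moll \<eta> u x = conv \<eta> u x" using even by (simp add: moll_def add.commute)
qed

section \<open>A Lipschitz partition of unity\<close>

definition clamp01 :: "nat \<Rightarrow> real \<Rightarrow> real" where
  "clamp01 n t = max 0 (min 1 (2 ^ n * t - 1))"

lemma clamp01_eq_0: "2 ^ n * t \<le> 1 \<Longrightarrow> clamp01 n t = 0"
  and clamp01_eq_1: "2 ^ n * t \<ge> 2 \<Longrightarrow> clamp01 n t = 1"
  by (auto simp: clamp01_def)

lemma clamp01_lipschitz: "\<bar>clamp01 n s - clamp01 n t\<bar> \<le> 2 ^ n * \<bar>s - t\<bar>"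
proof -
  have "\<bar>clamp01 n s - clamp01 n t\<bar> \<le> \<bar>2 ^ n * s - 2 ^ n * t\<bar>"
    by (auto simp: clamp01_def)
  also have "\<dots> = 2 ^ n * \<bar>s - t\<bar>" by (simp add: abs_mult flip: right_diff_distrib)
  finally show ?thesis .
qed

lemma clamp01_le_Suc: "0 \<le> t \<Longrightarrow> clamp01 n t \<le> clamp01 (Suc n) t"
proof -
  assume "0 \<le> t"
  then have "2 ^ n * t \<le> 2 ^ Suc n * t" by (intro mult_right_mono) auto
  then show ?thesis unfolding clamp01_def by linarith
qed

text \<open>Only the mollified pieces have to be smooth, so a Lipschitz partition suffices. It consists of
  tent functions of a single Lipschitz function \<open>\<delta>\<close> that is positive exactly on \<open>\<Omega>\<close> and tends
  to zero both at the boundary and at infinity.\<close>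

lemma lipschitz_partition_of_unity:
  fixes \<Omega> :: "'a::euclidean_space set"
  assumes "open \<Omega>"
  obtains \<phi> :: "nat \<Rightarrow> 'a \<Rightarrow> real" and L R :: "nat \<Rightarrow> real" where
    "\<And>j x. 0 \<le> \<phi> j x" "\<And>j x. \<phi> j x \<le> 1"
    "\<And>j x y. \<bar>\<phi> j x - \<phi> j y\<bar> \<le> L j * norm (x - y)"
    "\<And>j x. x \<notin> \<Omega> \<Longrightarrow> \<phi> j x = 0" "\<And>j x. norm x \<ge> R j \<Longrightarrow> \<phi> j x = 0"
    "\<And>x. x \<in> \<Omega> \<Longrightarrow> \<exists>r>0. \<exists>N. \<forall>j\<ge>N. \<forall>y. dist x y < r \<longrightarrow> \<phi> j y = 0"
    "\<And>x. x \<in> \<Omega> \<Longrightarrow> (\<lambda>j. \<phi> j x) sums 1"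
proof -
  (* infdist x {} is 0, so the absence of a boundary needs its own case. *)
  define b where "b x = (if \<Omega> = UNIV then 1 else infdist x (- \<Omega>))" for x
  define \<delta> where "\<delta> x = min (b x) (1 / (1 + norm x))" for x
  have b_lip: "\<bar>b x - b y\<bar> \<le> norm (x - y)" for x y
    using infdist_triangle_abs[of x "- \<Omega>" y] by (simp add: b_def dist_norm)
  have n_lip: "\<bar>1 / (1 + norm x) - 1 / (1 + norm y)\<bar> \<le> norm (x - y)" for x y :: 'a
  proof -
    have pos: "1 + norm x > 0" "1 + norm y > 0" by (auto intro: add_pos_nonneg)
    have "1 / (1 + norm x) - 1 / (1 + norm y) = (norm y - norm x) / ((1 + norm x) * (1 + norm y))"
      using pos by (simp add: field_simps)
    then have "\<bar>1 / (1 + norm x) - 1 / (1 + norm y)\<bar> = \<bar>norm y - norm x\<bar> / ((1 + norm x) * (1 + norm y))"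
      using pos by (simp add: abs_mult)
    also have "\<dots> \<le> \<bar>norm y - norm x\<bar> / 1"
    proof (rule divide_left_mono)
      have "1 * 1 \<le> (1 + norm x) * (1 + norm y)" by (intro mult_mono) auto
      then show "1 \<le> (1 + norm x) * (1 + norm y)" by simp
    qed (use pos in auto)
    also have "\<dots> \<le> norm (x - y)" using norm_triangle_ineq3[of y x] by (simp add: norm_minus_commute)
    finally show ?thesis .
  qed
  have \<delta>_lip: "\<bar>\<delta> x - \<delta> y\<bar> \<le> norm (x - y)" for x y
    using b_lip[of x y] n_lip[of x y] unfolding \<delta>_def by linarith
  have \<delta>0: "0 \<le> \<delta> x" for x by (auto simp: \<delta>_def b_def infdist_nonneg)
  have \<delta>1: "\<delta> x \<le> 1" for x
  proof -
    have "1 / (1 + norm x) \<le> 1" by (simp add: divide_le_eq_1 add_pos_nonneg)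
    then show ?thesis unfolding \<delta>_def by linarith
  qed
  have \<delta>_out: "\<delta> x = 0" if "x \<notin> \<Omega>" for x
    using that \<delta>0[of x] by (auto simp: \<delta>_def b_def)
  have \<delta>_pos: "\<delta> x > 0" if "x \<in> \<Omega>" for x
  proof -
    have "b x > 0"
    proof (cases "\<Omega> = UNIV")
      case False
      then have "- \<Omega> \<noteq> {}" "closed (- \<Omega>)" using assms by auto
      with that infdist_pos_not_in_closed[of "- \<Omega>" x] show ?thesis using False by (auto simp: b_def)
    qed (simp add: b_def)
    then show ?thesis by (simp add: \<delta>_def add_pos_nonneg)
  qed
  have \<delta>_norm: "2 ^ n * \<delta> x \<le> 1" if "norm x \<ge> 2 ^ n" for n x
  proof -
    have "2 ^ n * \<delta> x \<le> 2 ^ n * (1 / (1 + norm x))"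
      by (intro mult_left_mono) (auto simp: \<delta>_def)
    also have "\<dots> \<le> 1" using that by (simp add: field_simps add_pos_nonneg)
    finally show ?thesis .
  qed
  define \<phi> where "\<phi> j x = clamp01 (Suc j) (\<delta> x) - clamp01 j (\<delta> x)" for j x
  show ?thesis
  proof (rule that[of \<phi> "\<lambda>j. 2 ^ Suc j + 2 ^ j" "\<lambda>j. 2 ^ Suc j"])
    fix j x
    show "0 \<le> \<phi> j x" using clamp01_le_Suc[OF \<delta>0, of j x] by (simp add: \<phi>_def)
    show "\<phi> j x \<le> 1" by (auto simp: \<phi>_def clamp01_def)
    show "x \<notin> \<Omega> \<Longrightarrow> \<phi> j x = 0" using \<delta>_out[of x] by (simp add: \<phi>_def clamp01_def)
    show "\<phi> j x = 0" if "norm x \<ge> 2 ^ Suc j"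
    proof -
      have "(2::real) ^ j \<le> 2 ^ Suc j" by simp
      then have "norm x \<ge> 2 ^ j" using that by linarith
      then show ?thesis using clamp01_eq_0[OF \<delta>_norm[OF that]] clamp01_eq_0[OF \<delta>_norm]
        by (simp add: \<phi>_def)
    qed
  next
    fix j x y
    have "\<bar>\<phi> j x - \<phi> j y\<bar> \<le> \<bar>clamp01 (Suc j) (\<delta> x) - clamp01 (Suc j) (\<delta> y)\<bar> + \<bar>clamp01 j (\<delta> x) - clamp01 j (\<delta> y)\<bar>"
      unfolding \<phi>_def by linarith
    also have "\<dots> \<le> 2 ^ Suc j * \<bar>\<delta> x - \<delta> y\<bar> + 2 ^ j * \<bar>\<delta> x - \<delta> y\<bar>"
      by (intro add_mono clamp01_lipschitz)
    also have "\<dots> = (2 ^ Suc j + 2 ^ j) * \<bar>\<delta> x - \<delta> y\<bar>" by (simp add: algebra_simps)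
    also have "\<dots> \<le> (2 ^ Suc j + 2 ^ j) * norm (x - y)"
      by (intro mult_left_mono \<delta>_lip) auto
    finally show "\<bar>\<phi> j x - \<phi> j y\<bar> \<le> (2 ^ Suc j + 2 ^ j) * norm (x - y)" .
  next
    fix x assume x: "x \<in> \<Omega>"
    have big: "\<exists>N. \<forall>j\<ge>N. 2 ^ j * t \<ge> 2" if "t > 0" for t :: real
    proof -
      obtain N where N: "2 / t < 2 ^ N" using real_arch_pow[of 2 "2 / t"] by auto
      have "2 ^ j * t \<ge> 2" if "j \<ge> N" for j
      proof -
        have "2 / t \<le> 2 ^ j"
          using N power_increasing[OF that, of "2::real"] by linarith
        then show ?thesis using \<open>t > 0\<close> by (simp add: field_simps)
      qed
      then show ?thesis by blast
    qed
    obtain N where N: "\<And>j. j \<ge> N \<Longrightarrow> 2 ^ j * (\<delta> x / 2) \<ge> 2" using big[of "\<delta> x / 2"] \<delta>_pos[OF x] by auto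
    have "\<phi> j y = 0" if "j \<ge> N" "dist x y < \<delta> x / 2" for j y
    proof -
      have "\<delta> x / 2 \<le> \<delta> y" using \<delta>_lip[of x y] that(2) unfolding dist_norm by linarith
      then have "2 ^ i * (\<delta> x / 2) \<le> 2 ^ i * \<delta> y" for i by (intro mult_left_mono) auto
      then have "2 ^ j * \<delta> y \<ge> 2" "2 ^ Suc j * \<delta> y \<ge> 2"
        using N[of j] N[of "Suc j"] that(1) by (meson le_SucI order_trans)+
      then show ?thesis using clamp01_eq_1[of j "\<delta> y"] clamp01_eq_1[of "Suc j" "\<delta> y"] by (simp add: \<phi>_def)
    qed
    then show "\<exists>r>0. \<exists>N. \<forall>j\<ge>N. \<forall>y. dist x y < r \<longrightarrow> \<phi> j y = 0"
      using \<delta>_pos[OF x] by (intro exI[of _ "\<delta> x / 2"]) auto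
    obtain M where M: "\<And>j. j \<ge> M \<Longrightarrow> 2 ^ j * \<delta> x \<ge> 2" using big[OF \<delta>_pos[OF x]] by auto
    (* The telescoping sum starts at clamp01 0 (\<delta> x), which vanishes because \<delta> is at most 1. *)
    have "(\<lambda>j. clamp01 j (\<delta> x)) \<longlonglongrightarrow> 1"
      by (rule tendsto_eventually) (use clamp01_eq_1[OF M] in \<open>auto simp: eventually_sequentially\<close>)
    from telescope_sums[OF this] have "(\<lambda>j. \<phi> j x) sums (1 - clamp01 0 (\<delta> x))"
      by (simp add: \<phi>_def)
    then show "(\<lambda>j. \<phi> j x) sums 1" using clamp01_eq_0[of 0 "\<delta> x"] \<delta>1[of x] by simp
  qed
qed

section \<open>Multiplication by a Lipschitz cutoff\<close>

lemma min_lipschitz_powr_le: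
  fixes L s p :: real
  assumes "0 \<le> s" "1 \<le> p" "0 \<le> t" "t \<le> L * s" "t \<le> 1"
  shows "t powr p \<le> max L 1 powr p * min (s powr p) 1"
proof -
  have "t \<le> max L 1 * min s 1"
  proof (cases "s \<le> 1")
    case True
    have "L * s \<le> max L 1 * s" using assms(1) by (intro mult_right_mono) auto
    then show ?thesis using True assms(4) by simp
  qed (use assms in auto)
  then have "t powr p \<le> (max L 1 * min s 1) powr p" using assms by (intro powr_mono2) auto
  also have "\<dots> = max L 1 powr p * min s 1 powr p" using assms by (simp add: powr_mult)
  also have "min s 1 powr p = min (s powr p) 1"
    using assms powr_mono2[of p s 1] powr_mono2[of p 1 s] by (auto simp: min_def)
  finally show ?thesis .
qed

text \<open>By the product rule for differences, the cutoff costs only terms of the form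
  \<open>\<bar>F\<bar>\<^sup>p (\<bar>h\<bar>\<^sup>p \<and> 1)\<close>, which is where the integrability of the kernel enters. Since the cutoff vanishes
  outside \<open>\<Omega>\<close>, the same bound controls the pairs with exactly one point in \<open>\<Omega>\<close>, so that the product
  has finite energy on the whole space.\<close>

lemma energy_cutoff_finite:
  fixes F \<phi> :: "'a::euclidean_space \<Rightarrow> real"
  assumes p: "1 \<le> p" and [measurable]: "F \<in> borel_measurable borel" "k \<in> borel_measurable borel"
      "\<phi> \<in> borel_measurable borel" "\<Omega> \<in> sets borel"
    and k: "(\<integral>\<^sup>+h. ennreal (k h) * ennreal (min (norm h powr p) 1) \<partial>lborel) < \<infinity>"
    and \<phi>: "\<And>x. 0 \<le> \<phi> x" "\<And>x. \<phi> x \<le> 1" "\<And>x y. \<bar>\<phi> x - \<phi> y\<bar> \<le> L * norm (x - y)"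
      "\<And>x. x \<notin> \<Omega> \<Longrightarrow> \<phi> x = 0"
    and fin: "Lp_pow p F < \<infinity>" "energy p k \<Omega> F < \<infinity>"
  shows "energy p k UNIV (\<lambda>x. F x * \<phi> x) < \<infinity>"
proof -
  define C where "C = ennreal (max L 1 powr p) * Lp_pow p F"
  define I where "I h = Lp_pow p (\<lambda>x. (F (x + h) - F x) * indicator \<Omega> x * indicator \<Omega> (x + h))" for h
  define m where "m h = ennreal (min (norm h powr p) 1)" for h :: 'a
  have [measurable]: "m \<in> borel_measurable borel" "I \<in> borel_measurable borel"
    unfolding m_def[abs_def] I_def[abs_def] Lp_pow_def by measurable
  have IE: "energy p k \<Omega> F = (\<integral>\<^sup>+h. ennreal (k h) * I h \<partial>lborel)"
    unfolding energy_def I_def Lp_pow_def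
    by (intro nn_integral_cong arg_cong2[where f="(*)"]) (auto simp: indicator_def)
  have bound: "Lp_pow p (\<lambda>x. F (x + h) * \<phi> (x + h) - F x * \<phi> x) \<le>
      ennreal (3 powr p) * (I h + 2 * (C * m h))" for h
  proof -
    have d: "\<bar>\<phi> (x + h) - \<phi> x\<bar> powr p \<le> max L 1 powr p * min (norm h powr p) 1" for x
      using \<phi>(1)[of x] \<phi>(1)[of "x + h"] \<phi>(2)[of x] \<phi>(2)[of "x + h"] \<phi>(3)[of "x + h" x]
      by (intro min_lipschitz_powr_le p) (auto simp: abs_le_iff)
    have g: "Lp_pow p (\<lambda>x. G x * (\<phi> (x + h) - \<phi> x)) \<le> C * m h"
      if [measurable]: "G \<in> borel_measurable borel" and G: "Lp_pow p G = Lp_pow p F" for G :: "'a \<Rightarrow> real"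
    proof -
      have "ennreal (\<bar>G x * (\<phi> (x + h) - \<phi> x)\<bar> powr p) \<le>
        ennreal (max L 1 powr p) * m h * ennreal (\<bar>G x\<bar> powr p)" for x
      proof -
        have "\<bar>G x * (\<phi> (x + h) - \<phi> x)\<bar> powr p \<le> (max L 1 powr p * min (norm h powr p) 1) * \<bar>G x\<bar> powr p"
          using mult_right_mono[OF d[of x], of "\<bar>G x\<bar> powr p"] by (simp add: abs_mult powr_mult mult.commute)
        then have "ennreal (\<bar>G x * (\<phi> (x + h) - \<phi> x)\<bar> powr p) \<le>
           ennreal ((max L 1 powr p * min (norm h powr p) 1) * \<bar>G x\<bar> powr p)" by (rule ennreal_leI)
        then show ?thesis by (simp add: m_def ennreal_mult)
      qed
      then have "Lp_pow p (\<lambda>x. G x * (\<phi> (x + h) - \<phi> x)) \<le>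
        (\<integral>\<^sup>+x. ennreal (max L 1 powr p) * m h * ennreal (\<bar>G x\<bar> powr p) \<partial>lborel)"
        unfolding Lp_pow_def by (intro nn_integral_mono)
      also have "\<dots> = ennreal (max L 1 powr p) * m h * Lp_pow p G"
        unfolding Lp_pow_def by (rule nn_integral_cmult) simp
      finally show ?thesis by (simp add: G C_def mult_ac)
    qed
    have "Lp_pow p (\<lambda>x. F (x + h) * \<phi> (x + h) - F x * \<phi> x) \<le> ennreal (3 powr p) *
      (I h + Lp_pow p (\<lambda>x. F x * (\<phi> (x + h) - \<phi> x)) + Lp_pow p (\<lambda>x. F (x + h) * (\<phi> (x + h) - \<phi> x)))"
      unfolding I_def
    proof (rule Lp_pow_sum3_le)
      fix x
      show "\<bar>F (x + h) * \<phi> (x + h) - F x * \<phi> x\<bar> \<le> \<bar>(F (x + h) - F x) * indicator \<Omega> x * indicator \<Omega> (x + h)\<bar>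
        + \<bar>F x * (\<phi> (x + h) - \<phi> x)\<bar> + \<bar>F (x + h) * (\<phi> (x + h) - \<phi> x)\<bar>"
      proof (cases "x \<in> \<Omega> \<and> x + h \<in> \<Omega>")
        case True
        have "F (x + h) * \<phi> (x + h) - F x * \<phi> x = \<phi> (x + h) * (F (x + h) - F x) + F x * (\<phi> (x + h) - \<phi> x)"
          by (simp add: algebra_simps)
        moreover have "\<bar>\<phi> (x + h) * (F (x + h) - F x)\<bar> \<le> 1 * \<bar>F (x + h) - F x\<bar>"
          unfolding abs_mult using \<phi>(1,2) by (intro mult_right_mono) auto
        ultimately show ?thesis using True by simp
      next
        case False
        then show ?thesis using \<phi>(4)[of x] \<phi>(4)[of "x + h"] by auto
      qed
    qed (use p in auto)
    also have "\<dots> \<le> ennreal (3 powr p) * (I h + C * m h + C * m h)"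
      by (intro mult_left_mono add_mono g order_refl Lp_pow_shift) auto
    finally show ?thesis by (simp add: mult_2 add.assoc)
  qed
  have "energy p k UNIV (\<lambda>x. F x * \<phi> x) \<le>
     (\<integral>\<^sup>+h. ennreal (3 powr p) * (ennreal (k h) * I h + (2 * C) * (ennreal (k h) * m h)) \<partial>lborel)"
    unfolding energy_UNIV
  proof (rule nn_integral_mono)
    fix h
    have "ennreal (k h) * Lp_pow p (\<lambda>x. F (x + h) * \<phi> (x + h) - F x * \<phi> x) \<le>
       ennreal (k h) * (ennreal (3 powr p) * (I h + 2 * (C * m h)))"
      by (intro mult_left_mono bound) simp
    also have "\<dots> = ennreal (3 powr p) * (ennreal (k h) * I h + (2 * C) * (ennreal (k h) * m h))"
      by (simp add: distrib_left mult_ac)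
    finally show "ennreal (k h) * Lp_pow p (\<lambda>x. F (x + h) * \<phi> (x + h) - F x * \<phi> x) \<le> \<dots>" .
  qed
  also have "\<dots> = ennreal (3 powr p) * ((\<integral>\<^sup>+h. ennreal (k h) * I h \<partial>lborel)
     + (2 * C) * (\<integral>\<^sup>+h. ennreal (k h) * m h \<partial>lborel))"
    by (simp add: nn_integral_cmult nn_integral_add)
  also have "\<dots> < \<infinity>"
    using fin k IE by (simp add: ennreal_mult_less_top C_def m_def)
  finally show ?thesis .
qed

section \<open>Locally finite sums of smooth pieces\<close>

text \<open>The weights \<open>2\<^sup>j\<^sup>+\<^sup>1\<close> bound a sum by its largest weighted term, so that countably many errors can
  be added up inside the \<open>p\<close>-th power without Minkowski's inequality: the price is a factor that is
  absorbed by choosing the individual errors small enough.\<close>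

lemma abs_sum_powr_le:
  fixes a :: "nat \<Rightarrow> real"
  assumes "0 \<le> p"
  shows "\<bar>\<Sum>j<N. a j\<bar> powr p \<le> (\<Sum>j<N. (2 ^ Suc j * \<bar>a j\<bar>) powr p)"
proof (cases "N = 0")
  case False
  let ?S = "(\<lambda>j. 2 ^ Suc j * \<bar>a j\<bar>) ` {..<N}"
  define M where "M = Max ?S"
  have S: "finite ?S" "?S \<noteq> {}" using False by auto
  from Max_in[OF S] obtain i where i: "i < N" "M = 2 ^ Suc i * \<bar>a i\<bar>" unfolding M_def by auto
  then have M0: "M \<ge> 0" by simp
  have "(\<Sum>j<n. (1 / 2) ^ Suc j) = 1 - (1 / 2 :: real) ^ n" for n
    by (induction n) (auto simp: field_simps)
  then have half: "(\<Sum>j<N. (1 / 2) ^ Suc j) \<le> (1::real)" by simp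
  have "\<bar>\<Sum>j<N. a j\<bar> \<le> (\<Sum>j<N. \<bar>a j\<bar>)" by (rule sum_abs)
  also have "\<dots> \<le> (\<Sum>j<N. M * (1 / 2) ^ Suc j)"
  proof (rule sum_mono)
    fix j assume "j \<in> {..<N}"
    then have "2 ^ Suc j * \<bar>a j\<bar> \<le> M" unfolding M_def using S by (intro Max_ge) auto
    then show "\<bar>a j\<bar> \<le> M * (1 / 2) ^ Suc j" by (simp add: power_divide field_simps)
  qed
  also have "\<dots> = M * (\<Sum>j<N. (1 / 2) ^ Suc j)" by (simp add: sum_distrib_left)
  also have "\<dots> \<le> M * 1" by (intro mult_left_mono half M0)
  finally have "\<bar>\<Sum>j<N. a j\<bar> powr p \<le> M powr p" using assms by (intro powr_mono2) auto
  also have "\<dots> \<le> (\<Sum>j<N. (2 ^ Suc j * \<bar>a j\<bar>) powr p)"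
    unfolding i(2) by (rule member_le_sum) (use i in auto)
  finally show ?thesis .
qed simp

definition piece_weight :: "real \<Rightarrow> nat \<Rightarrow> real" where
  "piece_weight p j = (2 ^ Suc j) powr p"

lemma piece_weight_pos: "piece_weight p j > 0"
  by (simp add: piece_weight_def)

lemma ennreal_abs_sum_powr_le:
  fixes a :: "nat \<Rightarrow> real"
  assumes "0 \<le> p"
  shows "ennreal (\<bar>\<Sum>j<N. a j\<bar> powr p) \<le> (\<Sum>j. ennreal (piece_weight p j) * ennreal (\<bar>a j\<bar> powr p))"
proof -
  have "ennreal (\<bar>\<Sum>j<N. a j\<bar> powr p) \<le> ennreal (\<Sum>j<N. (2 ^ Suc j * \<bar>a j\<bar>) powr p)"
    by (intro ennreal_leI abs_sum_powr_le assms)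
  also have "\<dots> = ennreal (\<Sum>j<N. piece_weight p j * \<bar>a j\<bar> powr p)"
    by (simp add: powr_mult piece_weight_def del: power_Suc)
  also have "\<dots> = (\<Sum>j<N. ennreal (piece_weight p j) * ennreal (\<bar>a j\<bar> powr p))"
    by (subst sum_ennreal[symmetric])
      (auto simp: ennreal_mult less_imp_le[OF piece_weight_pos])
  also have "\<dots> \<le> (\<Sum>j. ennreal (piece_weight p j) * ennreal (\<bar>a j\<bar> powr p))"
    by (rule sum_le_suminf) auto
  finally show ?thesis .
qed

lemma locally_finite_sum_Lp_pow_le:
  fixes D :: "'a::euclidean_space \<Rightarrow> real"
  assumes p: "0 \<le> p" and [measurable]: "\<And>j. a j \<in> borel_measurable borel"
    and D: "\<And>x. x \<in> \<Omega> \<Longrightarrow> \<exists>N. \<forall>M\<ge>N. D x = (\<Sum>j<M. a j x)" "\<And>x. x \<notin> \<Omega> \<Longrightarrow> D x = 0"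
  shows "Lp_pow p D \<le> (\<Sum>j. ennreal (piece_weight p j) * Lp_pow p (a j))"
proof -
  have "Lp_pow p D \<le> (\<integral>\<^sup>+x. (\<Sum>j. ennreal (piece_weight p j) * ennreal (\<bar>a j x\<bar> powr p)) \<partial>lborel)"
    unfolding Lp_pow_def
  proof (rule nn_integral_mono)
    fix x
    show "ennreal (\<bar>D x\<bar> powr p) \<le> (\<Sum>j. ennreal (piece_weight p j) * ennreal (\<bar>a j x\<bar> powr p))"
    proof (cases "x \<in> \<Omega>")
      case True
      then obtain N where "D x = (\<Sum>j<N. a j x)" using D(1) by blast
      then show ?thesis using ennreal_abs_sum_powr_le[OF p, of "\<lambda>j. a j x" N] by simp
    qed (simp add: D(2))
  qed
  also have "\<dots> = (\<Sum>j. ennreal (piece_weight p j) * Lp_pow p (a j))"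
    unfolding Lp_pow_def by (simp add: nn_integral_suminf nn_integral_cmult)
  finally show ?thesis .
qed

lemma locally_finite_sum_energy_le:
  fixes D :: "'a::euclidean_space \<Rightarrow> real"
  assumes p: "0 \<le> p" and [measurable]: "\<And>j. a j \<in> borel_measurable borel" "k \<in> borel_measurable borel"
    and D: "\<And>x. x \<in> \<Omega> \<Longrightarrow> \<exists>N. \<forall>M\<ge>N. D x = (\<Sum>j<M. a j x)"
  shows "energy p k \<Omega> D \<le> (\<Sum>j. ennreal (piece_weight p j) * energy p k UNIV (a j))"
proof -
  have le: "(\<integral>\<^sup>+x. ennreal (\<bar>D (x + h) - D x\<bar> powr p) * indicator \<Omega> x * indicator \<Omega> (x + h) \<partial>lborel) \<le>
     (\<Sum>j. ennreal (piece_weight p j) * Lp_pow p (\<lambda>x. a j (x + h) - a j x))" for h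
  proof -
    have "ennreal (\<bar>D (x + h) - D x\<bar> powr p) * indicator \<Omega> x * indicator \<Omega> (x + h) \<le>
      (\<Sum>j. ennreal (piece_weight p j) * ennreal (\<bar>a j (x + h) - a j x\<bar> powr p))" for x
    proof (cases "x \<in> \<Omega> \<and> x + h \<in> \<Omega>")
      case True
      then obtain N N' where "\<forall>M\<ge>N. D x = (\<Sum>j<M. a j x)" "\<forall>M\<ge>N'. D (x + h) = (\<Sum>j<M. a j (x + h))"
        using D by blast
      then have "D x = (\<Sum>j<max N N'. a j x)" "D (x + h) = (\<Sum>j<max N N'. a j (x + h))"
        by (meson max.cobounded1 max.cobounded2)+
      then have "D (x + h) - D x = (\<Sum>j<max N N'. a j (x + h) - a j x)"
        by (simp add: sum_subtractf)
      then show ?thesis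
        using ennreal_abs_sum_powr_le[OF p, of "\<lambda>j. a j (x + h) - a j x" "max N N'"] True by simp
    qed auto
    then have "(\<integral>\<^sup>+x. ennreal (\<bar>D (x + h) - D x\<bar> powr p) * indicator \<Omega> x * indicator \<Omega> (x + h) \<partial>lborel) \<le>
      (\<integral>\<^sup>+x. (\<Sum>j. ennreal (piece_weight p j) * ennreal (\<bar>a j (x + h) - a j x\<bar> powr p)) \<partial>lborel)"
      by (rule nn_integral_mono)
    also have "\<dots> = (\<Sum>j. ennreal (piece_weight p j) * Lp_pow p (\<lambda>x. a j (x + h) - a j x))"
      unfolding Lp_pow_def by (simp add: nn_integral_suminf nn_integral_cmult)
    finally show ?thesis .
  qed
  have [measurable]: "(\<lambda>h. Lp_pow p (\<lambda>x. a j (x + h) - a j x)) \<in> borel_measurable borel" for j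
    unfolding Lp_pow_def by measurable
  have "energy p k \<Omega> D \<le> (\<integral>\<^sup>+h. ennreal (k h) *
      (\<Sum>j. ennreal (piece_weight p j) * Lp_pow p (\<lambda>x. a j (x + h) - a j x)) \<partial>lborel)"
    unfolding energy_def by (intro nn_integral_mono mult_left_mono le) simp
  also have "\<dots> = (\<integral>\<^sup>+h. (\<Sum>j. ennreal (piece_weight p j) *
      (ennreal (k h) * Lp_pow p (\<lambda>x. a j (x + h) - a j x))) \<partial>lborel)"
    by (simp add: mult.left_commute flip: ennreal_suminf_cmult)
  also have "\<dots> = (\<Sum>j. ennreal (piece_weight p j) * energy p k UNIV (a j))"
    unfolding energy_UNIV by (simp add: nn_integral_suminf nn_integral_cmult)
  finally show ?thesis .
qed

text \<open>On the ball that contains the support, \<open>\<bar>t\<bar> \<le> 1 + \<bar>t\<bar>\<^sup>p\<close>.\<close>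

lemma integrable_of_Lp_bounded_support:
  fixes u :: "'a::euclidean_space \<Rightarrow> real"
  assumes [measurable]: "u \<in> borel_measurable borel" and p: "1 \<le> p" and fin: "Lp_pow p u < \<infinity>"
    and supp: "\<And>x. norm x \<ge> R \<Longrightarrow> u x = 0"
  shows "integrable lborel u"
proof (rule integrableI_bounded)
  have [measurable]: "cball (0::'a) R \<in> sets borel" by simp
  have "ennreal (norm (u x)) \<le> indicator (cball 0 R) x + ennreal (\<bar>u x\<bar> powr p)" for x
  proof (cases "\<bar>u x\<bar> \<le> 1")
    case True
    show ?thesis
    proof (cases "norm x \<le> R")
      case True
      then have "ennreal (norm (u x)) \<le> indicator (cball 0 R) x" using \<open>\<bar>u x\<bar> \<le> 1\<close> by simp
      then show ?thesis by (simp add: add_increasing2)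
    qed (simp add: supp)
  next
    case False
    then have "\<bar>u x\<bar> \<le> \<bar>u x\<bar> powr p" using powr_mono[of 1 p "\<bar>u x\<bar>"] p by simp
    then have "ennreal (norm (u x)) \<le> ennreal (\<bar>u x\<bar> powr p)" by (simp add: ennreal_leI)
    then show ?thesis by (simp add: add_increasing)
  qed
  then have "(\<integral>\<^sup>+x. ennreal (norm (u x)) \<partial>lborel) \<le>
      (\<integral>\<^sup>+x. indicator (cball 0 R) x + ennreal (\<bar>u x\<bar> powr p) \<partial>lborel)"
    by (rule nn_integral_mono)
  also have "\<dots> = emeasure lborel (cball (0::'a) R) + Lp_pow p u"
    unfolding Lp_pow_def by (subst nn_integral_add) auto
  also have "\<dots> < \<infinity>" using fin emeasure_lborel_cball_finite[of "0::'a" R] by simp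
  finally show "(\<integral>\<^sup>+x. ennreal (norm (u x)) \<partial>lborel) < \<infinity>" .
qed simp

lemma Lp_pow_mono: "(\<And>x. \<bar>u x\<bar> \<le> \<bar>v x\<bar>) \<Longrightarrow> 0 \<le> p \<Longrightarrow> Lp_pow p u \<le> Lp_pow p v"
  unfolding Lp_pow_def by (intro nn_integral_mono ennreal_leI powr_mono2) auto

text \<open>The last clause says that mollification enlarges the support by at most \<open>\<epsilon>\<close>; it keeps the family of
  mollified pieces locally finite.\<close>

lemma smooth_mollification:
  fixes u :: "'a::euclidean_space \<Rightarrow> real" and e \<epsilon> :: real
  assumes u: "integrable lborel u" and p: "1 \<le> p" and k: "k \<in> borel_measurable borel"
    and fin: "Lp_pow p u < \<infinity>" "energy p k UNIV u < \<infinity>" and e: "0 < e" "0 < \<epsilon>"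
  shows "\<exists>g. (\<forall>j. Ck_on j g UNIV) \<and>
    Lp_pow p (\<lambda>x. g x - u x) + energy p k UNIV (\<lambda>x. g x - u x) \<le> ennreal e \<and>
    (\<forall>x. (\<forall>y. dist x y < \<epsilon> \<longrightarrow> u y = 0) \<longrightarrow> g x = 0)"
proof (rule mollification_converges[OF u p k fin e(1)])
  fix d :: real
  assume d: "0 < d" "\<And>\<eta>. \<lbrakk>\<And>z. 0 \<le> \<eta> z; integrable lborel \<eta>; integral\<^sup>L lborel \<eta> = 1;
      \<exists>B. \<forall>z. \<bar>\<eta> z\<bar> \<le> B; \<And>z. norm z \<ge> d \<Longrightarrow> \<eta> z = 0\<rbrakk> \<Longrightarrow>
    Lp_pow p (\<lambda>x. moll \<eta> u x - u x) + energy p k UNIV (\<lambda>x. moll \<eta> u x - u x) \<le> ennreal e"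
  define r where "r = min d \<epsilon>"
  have "r > 0" using d(1) e(2) by (simp add: r_def)
  obtain \<eta> :: "'a \<Rightarrow> real"
    where \<eta>: "\<And>k. Ck_on k \<eta> UNIV" "\<And>x. 0 \<le> \<eta> x" "\<And>x. \<eta> (- x) = \<eta> x"
    "\<And>x. norm x \<ge> r \<Longrightarrow> \<eta> x = 0" "integrable lborel \<eta>" "integral\<^sup>L lborel \<eta> = 1"
    by (rule smooth_bump_exists[OF \<open>r > 0\<close>]) (rule that)
  have [measurable]: "\<eta> \<in> borel_measurable borel" "u \<in> borel_measurable borel" using \<eta>(5) u by auto
  have "\<exists>B. \<forall>z. \<bar>\<eta> z\<bar> \<le> B"
    by (rule bounded_support_continuous_bounded[OF Ck_on_continuous_on[OF \<eta>(1)[of 0]] \<eta>(4)]) auto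
  then have "Lp_pow p (\<lambda>x. moll \<eta> u x - u x) + energy p k UNIV (\<lambda>x. moll \<eta> u x - u x) \<le> ennreal e"
    using \<eta> by (intro d(2)) (auto simp: r_def)
  moreover have "Ck_on j (moll \<eta> u) UNIV" for j
    using Ck_on_conv[OF \<eta>(1,4) u] moll_eq_conv[of \<eta> u] \<eta>(3) by simp
  moreover have "moll \<eta> u x = 0" if "\<forall>y. dist x y < \<epsilon> \<longrightarrow> u y = 0" for x
  proof -
    have "\<eta> z * u (x + z) = 0" for z
    proof (cases "norm z < r")
      case True
      then show ?thesis using that by (simp add: r_def dist_norm)
    qed (use \<eta>(4)[of z] in simp)
    then have "(\<lambda>z. \<eta> z * u (x + z)) = (\<lambda>z. 0)" by (rule ext)
    then show ?thesis by (simp add: moll_def)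
  qed
  ultimately show ?thesis by blast
qed

text \<open>Each piece \<open>F * \<phi> j\<close> is mollified with a radius of at most \<open>1 / (j + 1)\<close>: since the radii tend to zero, the
  mollified pieces are still locally finite in \<open>\<Omega>\<close>, and their sum \<open>G\<close> is smooth there. The errors of
  the pieces add up to the error of the sum.\<close>

lemma smooth_approximation:
  fixes F :: "'a::euclidean_space \<Rightarrow> real" and e :: real
  assumes p: "1 \<le> p" and \<Omega>: "open \<Omega>" and [measurable]: "F \<in> borel_measurable borel" "k \<in> borel_measurable borel"
    and k: "(\<integral>\<^sup>+h. ennreal (k h) * ennreal (min (norm h powr p) 1) \<partial>lborel) < \<infinity>"
    and F0: "\<And>x. x \<notin> \<Omega> \<Longrightarrow> F x = 0"
    and fin: "Lp_pow p F < \<infinity>" "energy p k \<Omega> F < \<infinity>" and e: "0 < e"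
  obtains G where "\<And>j. Ck_on j G \<Omega>" "G \<in> borel_measurable borel" "\<And>x. x \<notin> \<Omega> \<Longrightarrow> G x = 0"
    "Lp_pow p (\<lambda>x. G x - F x) + energy p k \<Omega> (\<lambda>x. G x - F x) \<le> ennreal e"
proof -
  obtain \<phi> :: "nat \<Rightarrow> 'a \<Rightarrow> real" and L R :: "nat \<Rightarrow> real" where \<phi>:
    "\<And>j x. 0 \<le> \<phi> j x" "\<And>j x. \<phi> j x \<le> 1"
    "\<And>j x y. \<bar>\<phi> j x - \<phi> j y\<bar> \<le> L j * norm (x - y)"
    "\<And>j x. x \<notin> \<Omega> \<Longrightarrow> \<phi> j x = 0" "\<And>j x. norm x \<ge> R j \<Longrightarrow> \<phi> j x = 0"
    and \<phi>_fin: "\<And>x. x \<in> \<Omega> \<Longrightarrow> \<exists>r>0. \<exists>N. \<forall>j\<ge>N. \<forall>y. dist x y < r \<longrightarrow> \<phi> j y = 0"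
    and \<phi>_sum: "\<And>x. x \<in> \<Omega> \<Longrightarrow> (\<lambda>j. \<phi> j x) sums 1"
    by (rule lipschitz_partition_of_unity[OF \<Omega>]) (rule that)
  have [measurable]: "\<Omega> \<in> sets borel" using \<Omega> by simp
  have [measurable]: "\<phi> j \<in> borel_measurable borel" for j
  proof (rule borel_measurable_continuous_onI)
    have "\<bar>\<phi> j x - \<phi> j y\<bar> \<le> \<bar>L j\<bar> * norm (x - y)" for x y
      by (rule order_trans[OF \<phi>(3) mult_right_mono]) auto
    then have "(\<bar>L j\<bar>)-lipschitz_on UNIV (\<phi> j)"
      by (intro lipschitz_onI) (auto simp: dist_norm)
    then show "continuous_on UNIV (\<phi> j)" by (rule lipschitz_on_continuous_on)
  qed
  define u where "u j x = F x * \<phi> j x" for j x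
  have [measurable]: "u j \<in> borel_measurable borel" for j unfolding u_def[abs_def] by measurable
  have uE: "energy p k UNIV (u j) < \<infinity>" for j
    unfolding u_def by (rule energy_cutoff_finite[OF p _ _ _ _ k \<phi>(1-4) fin]) auto
  have "Lp_pow p (u j) \<le> Lp_pow p F" for j
    by (rule Lp_pow_mono) (use p \<phi>(1,2) in \<open>auto simp: u_def abs_mult intro!: mult_left_le\<close>)
  then have uL: "Lp_pow p (u j) < \<infinity>" for j using fin(1) by (rule le_less_trans)
  have uI: "integrable lborel (u j)" for j
    by (rule integrable_of_Lp_bounded_support[OF _ p uL, of _ "R j"]) (auto simp: u_def \<phi>(5))
  (* The weight that a piece receives in the summation of errors is divided out in advance. *)
  define err where "err j = e * (1 / 2) ^ Suc j / piece_weight p j" for j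
  have err: "err j > 0" for j using e piece_weight_pos[of p j] by (simp add: err_def)
  have "\<forall>j. \<exists>g. (\<forall>i. Ck_on i g UNIV) \<and>
    Lp_pow p (\<lambda>x. g x - u j x) + energy p k UNIV (\<lambda>x. g x - u j x) \<le> ennreal (err j) \<and>
    (\<forall>x. (\<forall>y. dist x y < inverse (real (Suc j)) \<longrightarrow> u j y = 0) \<longrightarrow> g x = 0)"
    by (intro allI smooth_mollification[OF uI p _ uL uE err]) auto
  then obtain g where g: "\<And>j i. Ck_on i (g j) UNIV"
    "\<And>j. Lp_pow p (\<lambda>x. g j x - u j x) + energy p k UNIV (\<lambda>x. g j x - u j x) \<le> ennreal (err j)"
    "\<And>j x. (\<And>y. dist x y < inverse (real (Suc j)) \<Longrightarrow> u j y = 0) \<Longrightarrow> g j x = 0"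
    by metis
  have [measurable]: "g j \<in> borel_measurable borel" for j
    by (rule borel_measurable_continuous_onI[OF Ck_on_continuous_on[OF g(1)]])
  define G where "G x = indicator \<Omega> x * (\<Sum>j. g j x)" for x
  have loc: "\<exists>r>0. \<exists>N. \<forall>y. dist x y < r \<longrightarrow> (\<forall>j\<ge>N. u j y = 0 \<and> g j y = 0)" if "x \<in> \<Omega>" for x
  proof -
    obtain r N where r: "r > 0" "\<And>j y. j \<ge> N \<Longrightarrow> dist x y < r \<Longrightarrow> \<phi> j y = 0"
      using \<phi>_fin[OF \<open>x \<in> \<Omega>\<close>] by blast
    obtain N' where N': "inverse (real (Suc N')) < r / 2" using reals_Archimedean[of "r / 2"] r(1) by auto
    have "u j y = 0 \<and> g j y = 0" if y: "dist x y < r / 2" and j: "j \<ge> max N N'" for j y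
    proof
      show "u j y = 0" using r(2)[of j y] r(1) y j by (simp add: u_def)
      have "inverse (real (Suc j)) \<le> inverse (real (Suc N'))"
        using j by (intro le_imp_inverse_le) auto
      then have small: "inverse (real (Suc j)) < r / 2" using N' by linarith
      show "g j y = 0"
      proof (rule g(3))
        fix w assume "dist y w < inverse (real (Suc j))"
        then have "dist x w < r" using dist_triangle[of x w y] y small by linarith
        then show "u j w = 0" using r(2)[of j w] j by (simp add: u_def)
      qed
    qed
    then show ?thesis using r(1) by (intro exI[of _ "r / 2"] conjI exI[of _ "max N N'"]) auto
  qed
  have G_sum: "G y = (\<Sum>j<M. g j y)" if "y \<in> \<Omega>" "\<And>j. j \<ge> M \<Longrightarrow> g j y = 0" for y M
  proof -
    have "(\<Sum>j. g j y) = (\<Sum>j<M. g j y)"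
      by (rule suminf_finite) (use that(2) in \<open>auto simp: not_less\<close>)
    then show ?thesis using that(1) by (simp add: G_def)
  qed
  have F_sum: "F y = (\<Sum>j<M. u j y)" if "y \<in> \<Omega>" "\<And>j. j \<ge> M \<Longrightarrow> u j y = 0" for y M
  proof -
    have "(\<lambda>j. u j y) sums (F y * 1)" unfolding u_def by (rule sums_mult[OF \<phi>_sum[OF that(1)]])
    moreover have "(\<lambda>j. u j y) sums (\<Sum>j<M. u j y)"
      by (rule sums_finite) (use that(2) in \<open>auto simp: not_less\<close>)
    ultimately show ?thesis using sums_unique2 by fastforce
  qed
  have G_smooth: "Ck_on i G \<Omega>" for i
  proof (rule Ck_on_local)
    fix x assume x: "x \<in> \<Omega>"
    obtain r N where r: "r > 0" "\<And>y j. dist x y < r \<Longrightarrow> j \<ge> N \<Longrightarrow> g j y = 0" using loc[OF x] by blast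
    have o: "open (ball x r \<inter> \<Omega>)" using \<Omega> by auto
    have "Ck_on i (\<lambda>y. \<Sum>j<N. g j y) (ball x r \<inter> \<Omega>)"
      by (rule Ck_on_sum[OF o]) (rule Ck_on_mono[OF g(1)], simp)
    then have "Ck_on i G (ball x r \<inter> \<Omega>)"
      by (rule Ck_on_cong_open[OF o, rotated]) (use r(2) in \<open>auto intro!: G_sum[symmetric]\<close>)
    then show "\<exists>U. open U \<and> x \<in> U \<and> Ck_on i G U"
      using o x r(1) by (intro exI[of _ "ball x r \<inter> \<Omega>"]) auto
  qed
  have G_meas: "G \<in> borel_measurable borel"
  proof -
    have "(\<lambda>x. if x \<in> \<Omega> then G x else 0) \<in> borel_measurable borel"
      by (rule borel_measurable_continuous_on_if) (auto intro: Ck_on_continuous_on[OF G_smooth])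
    moreover have "(\<lambda>x. if x \<in> \<Omega> then G x else 0) = G" by (auto simp: G_def)
    ultimately show ?thesis by simp
  qed
  have G0: "G x = 0" if "x \<notin> \<Omega>" for x using that by (simp add: G_def)
  define a where "a j x = g j x - u j x" for j x
  have [measurable]: "a j \<in> borel_measurable borel" for j unfolding a_def[abs_def] by measurable
  have fin_sum: "\<exists>N. \<forall>M\<ge>N. G x - F x = (\<Sum>j<M. a j x)" if x: "x \<in> \<Omega>" for x
  proof -
    obtain r N where r: "r > 0" "\<And>y j. dist x y < r \<Longrightarrow> j \<ge> N \<Longrightarrow> u j y = 0 \<and> g j y = 0"
      using loc[OF x] by blast
    have "G x - F x = (\<Sum>j<M. a j x)" if "M \<ge> N" for M
    proof -
      have "G x = (\<Sum>j<M. g j x)" "F x = (\<Sum>j<M. u j x)"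
        using r that by (auto intro!: G_sum F_sum x)
      then show ?thesis by (simp add: a_def sum_subtractf)
    qed
    then show ?thesis by blast
  qed
  have "Lp_pow p (\<lambda>x. G x - F x) \<le> (\<Sum>j. ennreal (piece_weight p j) * Lp_pow p (a j))"
    by (rule locally_finite_sum_Lp_pow_le[OF _ _ fin_sum]) (use p in \<open>auto simp: G0 F0\<close>)
  moreover have "energy p k \<Omega> (\<lambda>x. G x - F x) \<le> (\<Sum>j. ennreal (piece_weight p j) * energy p k UNIV (a j))"
    by (rule locally_finite_sum_energy_le[OF _ _ _ fin_sum]) (use p in auto)
  ultimately have "Lp_pow p (\<lambda>x. G x - F x) + energy p k \<Omega> (\<lambda>x. G x - F x) \<le>
     (\<Sum>j. ennreal (piece_weight p j) * Lp_pow p (a j)) + (\<Sum>j. ennreal (piece_weight p j) * energy p k UNIV (a j))"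
    by (rule add_mono)
  also have "\<dots> = (\<Sum>j. ennreal (piece_weight p j) * (Lp_pow p (a j) + energy p k UNIV (a j)))"
    by (simp add: suminf_add[OF summableI summableI] distrib_left)
  also have "\<dots> \<le> (\<Sum>j. ennreal (piece_weight p j) * ennreal (err j))"
    unfolding a_def by (intro suminf_le mult_left_mono g(2) summableI) auto
  also have "\<dots> = (\<Sum>j. ennreal (e * (1 / 2) ^ Suc j))"
  proof (rule suminf_cong)
    fix j
    have eq: "e * (1 / 2) ^ Suc j = piece_weight p j * err j"
      using piece_weight_pos[of p j] by (simp add: err_def)
    show "ennreal (piece_weight p j) * ennreal (err j) = ennreal (e * (1 / 2) ^ Suc j)"
      unfolding eq using piece_weight_pos[of p j] err[of j] by (intro ennreal_mult[symmetric]) auto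
  qed
  also have "\<dots> = ennreal (\<Sum>j. e * (1 / 2) ^ Suc j)"
    using e sums_summable[OF sums_mult[OF power_half_series, of e]] by (intro suminf_ennreal2) auto
  also have "(\<Sum>j. e * (1 / 2) ^ Suc j) = e"
    using sums_unique[OF sums_mult[OF power_half_series, of e]] by simp
  finally have "Lp_pow p (\<lambda>x. G x - F x) + energy p k \<Omega> (\<lambda>x. G x - F x) \<le> ennreal e" .
  with that[OF G_smooth G_meas G0] show ?thesis by blast
qed

section \<open>Radial kernels\<close>

text \<open>The area of the sphere of radius \<open>r\<close>, as the derivative of the volume of the ball.\<close>

definition radial_density :: "'a::euclidean_space itself \<Rightarrow> real \<Rightarrow> ennreal" where
  "radial_density _ r = ennreal (unit_ball_vol (real DIM('a)) * (real DIM('a) * r ^ (DIM('a) - 1))) * indicator {0..} r"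

text \<open>Polar coordinates for radial functions: both measures give \<open>{..r}\<close> the volume of the ball of
  radius \<open>r\<close>.\<close>

lemma distr_norm_lborel:
  "distr lborel borel (norm :: 'a::euclidean_space \<Rightarrow> real) = density lborel (radial_density TYPE('a))"
proof (rule measure_eqI_generator_eq[where E="range atMost" and \<Omega>=UNIV and A="\<lambda>n. {..real n}"])
  let ?c = "unit_ball_vol (real DIM('a))"
  have [measurable]: "radial_density TYPE('a) \<in> borel_measurable borel"
    unfolding radial_density_def[abs_def] by measurable
  have L: "emeasure (distr lborel borel (norm :: 'a \<Rightarrow> real)) {..a} = (if 0 \<le> a then ennreal (?c * a ^ DIM('a)) else 0)" for a
  proof -
    have "emeasure (distr lborel borel (norm :: 'a \<Rightarrow> real)) {..a} = emeasure lborel (norm -` {..a} :: 'a set)"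
      by (subst emeasure_distr) auto
    also have "norm -` {..a} = cball (0::'a) a" by auto
    finally show ?thesis by (simp add: emeasure_cball)
  qed
  have R: "emeasure (density lborel (radial_density TYPE('a))) {..a} = (if 0 \<le> a then ennreal (?c * a ^ DIM('a)) else 0)" for a
  proof (cases "0 \<le> a")
    case True
    have "emeasure (density lborel (radial_density TYPE('a))) {..a} =
      (\<integral>\<^sup>+r. ennreal (?c * (real DIM('a) * r ^ (DIM('a) - 1))) * indicator {0..a} r \<partial>lborel)"
      by (subst emeasure_density) (auto simp: radial_density_def indicator_def intro!: nn_integral_cong)
    also have "\<dots> = ennreal (?c * a ^ DIM('a) - ?c * 0 ^ DIM('a))"
      by (rule nn_integral_FTC_Icc) (use True in \<open>auto intro!: derivative_eq_intros\<close>)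
    finally show ?thesis using True by simp
  next
    case False
    then have "radial_density TYPE('a) r * indicator {..a} r = 0" for r
      by (auto simp: radial_density_def indicator_def)
    then have "(\<lambda>r. radial_density TYPE('a) r * indicator {..a} r) = (\<lambda>r. 0)" by (rule ext)
    then show ?thesis using False by (simp add: emeasure_density)
  qed
  show "emeasure (distr lborel borel (norm :: 'a \<Rightarrow> real)) X = emeasure (density lborel (radial_density TYPE('a))) X"
    if "X \<in> range atMost" for X
    using that L R by auto
  show "emeasure (distr lborel borel (norm :: 'a \<Rightarrow> real)) {..real n} \<noteq> \<infinity>" for n by (simp add: L)
  show "Int_stable (range (atMost :: real \<Rightarrow> real set))" by (auto simp: Int_stable_def)
  show "sets (distr lborel borel (norm :: 'a \<Rightarrow> real)) = sigma_sets UNIV (range atMost)"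
    "sets (density lborel (radial_density TYPE('a))) = sigma_sets UNIV (range atMost)"
    by (auto simp: borel_eq_atMost)
  show "(\<Union>n. {..real n}) = UNIV" using real_arch_simple by auto
qed auto

lemma nn_integral_radial:
  assumes [measurable]: "g \<in> borel_measurable borel"
  shows "(\<integral>\<^sup>+h. g (norm (h::'a::euclidean_space)) \<partial>lborel) = (\<integral>\<^sup>+r. radial_density TYPE('a) r * g r \<partial>lborel)"
proof -
  have [measurable]: "radial_density TYPE('a) \<in> borel_measurable borel"
    unfolding radial_density_def[abs_def] by measurable
  have "(\<integral>\<^sup>+h. g (norm (h::'a)) \<partial>lborel) = (\<integral>\<^sup>+r. g r \<partial>distr lborel borel (norm :: 'a \<Rightarrow> real))"
    by (rule nn_integral_distr[symmetric]) auto
  also have "\<dots> = (\<integral>\<^sup>+r. radial_density TYPE('a) r * g r \<partial>lborel)"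
    unfolding distr_norm_lborel by (rule nn_integral_density) auto
  finally show ?thesis .
qed

text \<open>In polar coordinates a null set of radii contributes nothing to the volume. This is what allows
  a radial kernel to be modified on a null set of radii.\<close>

lemma AE_lborel_norm:
  assumes "AE r in lborel. 0 \<le> r \<longrightarrow> P r"
  shows "AE h in lborel. P (norm (h::'a::euclidean_space))"
proof -
  obtain N where N: "N \<in> null_sets lborel" "{r. \<not> (0 \<le> r \<longrightarrow> P r)} \<subseteq> N"
    using assms by (auto simp: eventually_ae_filter)
  then have [measurable]: "N \<in> sets borel" by auto
  have "(\<integral>\<^sup>+h. indicator N (norm (h::'a)) \<partial>lborel) = (\<integral>\<^sup>+r. radial_density TYPE('a) r * indicator N r \<partial>lborel)"
    by (rule nn_integral_radial) simp
  also have "\<dots> = (\<integral>\<^sup>+r. 0 \<partial>(lborel :: real measure))"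
    by (rule nn_integral_cong_AE) (use AE_not_in[OF N(1)] in \<open>auto elim!: eventually_mono\<close>)
  finally have "(\<integral>\<^sup>+h. indicator N (norm (h::'a)) \<partial>lborel) = 0" by simp
  then have "AE h in lborel. indicator N (norm (h::'a)) = (0::ennreal)"
    by (subst (asm) nn_integral_0_iff_AE) auto
  then show ?thesis
  proof eventually_elim
    case (elim h)
    then have "norm h \<notin> N" by (simp add: indicator_def split: if_splits)
    then show ?case using N(2) norm_ge_zero[of h] by blast
  qed
qed

lemma AE_lborel_translate:
  assumes "AE h in lborel. P (h::'a::euclidean_space)"
  shows "AE y in lborel. P (y - x)"
proof -
  obtain N where N: "N \<in> null_sets lborel" "{h. \<not> P h} \<subseteq> N"
    using assms by (auto simp: eventually_ae_filter)
  have "{y. y - x \<in> N} \<in> null_sets lborel" by (rule null_sets_translation[OF N(1)])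
  from AE_not_in[OF this] show ?thesis by eventually_elim (use N(2) in auto)
qed

section \<open>Borel representatives\<close>

lemma borel_representative:
  fixes f :: "'a::euclidean_space \<Rightarrow> real"
  assumes [measurable]: "S \<in> sets borel" and "f \<in> borel_measurable (lebesgue_on S)"
  obtains F where "F \<in> borel_measurable borel" "\<And>x. x \<notin> S \<Longrightarrow> F x = 0" "AE x in lborel. x \<in> S \<longrightarrow> f x = F x"
proof -
  have "(\<lambda>x. indicator S x *\<^sub>R f x) \<in> borel_measurable lebesgue"
    using assms by (subst (asm) borel_measurable_restrict_space_iff) auto
  from completion_ex_borel_measurable_real[OF this] obtain g where
    g: "g \<in> borel_measurable lborel" "AE x in lborel. indicator S x *\<^sub>R f x = g x" by auto
  show ?thesis
  proof (rule that[of "\<lambda>x. indicator S x * g x"])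
    show "(\<lambda>x. indicator S x * g x) \<in> borel_measurable borel" using g(1) by simp
    show "AE x in lborel. x \<in> S \<longrightarrow> f x = indicator S x * g x"
      using g(2) by eventually_elim auto
  qed auto
qed

lemma nn_integral_lebesgue_on:
  fixes S :: "'a::euclidean_space set"
  assumes "S \<in> sets borel"
  shows "(\<integral>\<^sup>+x. g x \<partial>lebesgue_on S) = (\<integral>\<^sup>+x. g x * indicator S x \<partial>lborel)"
  using assms by (simp add: nn_integral_restrict_space nn_integral_completion)

lemma Lp_integral_eq_Lp_pow:
  fixes \<Omega> :: "'a::euclidean_space set"
  assumes "\<Omega> \<in> sets borel" "AE x in lborel. x \<in> \<Omega> \<longrightarrow> f x = F x" "\<And>x. x \<notin> \<Omega> \<Longrightarrow> F x = 0"
  shows "Lp_integral p \<Omega> f = Lp_pow p F"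
  unfolding Lp_integral_def Lp_pow_def nn_integral_lebesgue_on[OF assms(1)]
proof (rule nn_integral_cong_AE)
  show "AE x in lborel. ennreal (\<bar>f x\<bar> powr p) * indicator \<Omega> x = ennreal (\<bar>F x\<bar> powr p)"
    using assms(2) by eventually_elim (use assms(3) in \<open>auto simp: indicator_def\<close>)
qed

text \<open>For almost every \<open>x\<close>, replacing \<open>f\<close> and \<open>K\<close> by their representatives changes the inner integrand only
  for \<open>y\<close> in a null set, so both iterated integrals keep their values. After that everything is jointly
  Borel measurable and Fubini's theorem gives the coordinates \<open>(x, x + h)\<close>.\<close>

lemma double_integral_eq_energy:
  fixes \<Omega> :: "'a::euclidean_space set"
  assumes [measurable]: "\<Omega> \<in> sets borel" "F \<in> borel_measurable borel" "K' \<in> borel_measurable borel"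
    and f: "AE x in lborel. x \<in> \<Omega> \<longrightarrow> f x = F x"
    and K: "AE r in lborel. 0 \<le> r \<longrightarrow> K r = K' r" and K'0: "\<And>r. 0 \<le> K' r"
  shows "(\<integral>\<^sup>+x. (\<integral>\<^sup>+y. ennreal (\<bar>f x - f y\<bar> powr p * K (norm (x - y))) \<partial>lebesgue_on \<Omega>) \<partial>lebesgue_on \<Omega>)
    = energy p (\<lambda>h. K' (norm h)) \<Omega> F"
proof -
  let ?H = "\<lambda>x y. ennreal (\<bar>F x - F y\<bar> powr p) * ennreal (K' (norm (x - y))) * indicator \<Omega> y * indicator \<Omega> x"
  have inner: "(\<integral>\<^sup>+y. ennreal (\<bar>f x - f y\<bar> powr p * K (norm (x - y))) * indicator \<Omega> y \<partial>lborel) * indicator \<Omega> x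
     = (\<integral>\<^sup>+y. ?H x y \<partial>lborel)" if x: "x \<in> \<Omega> \<longrightarrow> f x = F x" for x
  proof (cases "x \<in> \<Omega>")
    case True
    have "AE y in lborel. K (norm (y - x)) = K' (norm (y - x))"
      by (rule AE_lborel_translate[OF AE_lborel_norm[OF K]])
    then have "(\<integral>\<^sup>+y. ennreal (\<bar>f x - f y\<bar> powr p * K (norm (x - y))) * indicator \<Omega> y \<partial>lborel) = (\<integral>\<^sup>+y. ?H x y \<partial>lborel)"
      using f
      by (intro nn_integral_cong_AE, eventually_elim)
        (use x True K'0 in \<open>auto simp: indicator_def norm_minus_commute ennreal_mult\<close>)
    then show ?thesis using True by simp
  qed simp
  have "(\<integral>\<^sup>+x. (\<integral>\<^sup>+y. ennreal (\<bar>f x - f y\<bar> powr p * K (norm (x - y))) \<partial>lebesgue_on \<Omega>) \<partial>lebesgue_on \<Omega>)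
    = (\<integral>\<^sup>+x. (\<integral>\<^sup>+y. ?H x y \<partial>lborel) \<partial>lborel)"
    unfolding nn_integral_lebesgue_on[OF assms(1)]
  proof (rule nn_integral_cong_AE)
    show "AE x in lborel. (\<integral>\<^sup>+y. ennreal (\<bar>f x - f y\<bar> powr p * K (norm (x - y))) * indicator \<Omega> y \<partial>lborel) * indicator \<Omega> x
     = (\<integral>\<^sup>+y. ?H x y \<partial>lborel)"
      using f by eventually_elim (rule inner)
  qed
  also have "\<dots> = (\<integral>\<^sup>+x. (\<integral>\<^sup>+h. ?H x (h + x) \<partial>lborel) \<partial>lborel)"
    by (intro nn_integral_cong nn_integral_lborel_shift[symmetric]) simp
  also have "\<dots> = (\<integral>\<^sup>+h. (\<integral>\<^sup>+x. ?H x (h + x) \<partial>lborel) \<partial>lborel)"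
    by (rule lborel_pair.Fubini') simp
  also have "\<dots> = energy p (\<lambda>h. K' (norm h)) \<Omega> F"
    unfolding energy_def
  proof (rule nn_integral_cong)
    fix h
    have "(\<integral>\<^sup>+x. ?H x (h + x) \<partial>lborel) = (\<integral>\<^sup>+x. ennreal (K' (norm h)) *
        (ennreal (\<bar>F (x + h) - F x\<bar> powr p) * indicator \<Omega> x * indicator \<Omega> (x + h)) \<partial>lborel)"
      by (intro nn_integral_cong) (simp add: add.commute abs_minus_commute mult_ac)
    also have "\<dots> = ennreal (K' (norm h)) *
        (\<integral>\<^sup>+x. ennreal (\<bar>F (x + h) - F x\<bar> powr p) * indicator \<Omega> x * indicator \<Omega> (x + h) \<partial>lborel)"
      by (rule nn_integral_cmult) simp
    finally show "(\<integral>\<^sup>+x. ?H x (h + x) \<partial>lborel) = \<dots>" .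
  qed
  finally show ?thesis .
qed

lemma kernel_representative:
  fixes K :: "real \<Rightarrow> real"
  assumes p: "1 \<le> p" and K0: "\<And>x. 0 \<le> x \<Longrightarrow> 0 \<le> K x"
    and K: "K \<in> borel_measurable (lebesgue_on {0..})"
    and fin: "(\<integral>\<^sup>+x. ennreal (min (x powr p) 1 * K x * x ^ (DIM('a) - 1)) \<partial>lebesgue_on {0..}) < \<infinity>"
  obtains K' where "K' \<in> borel_measurable borel" "\<And>r. 0 \<le> K' r" "AE r in lborel. 0 \<le> r \<longrightarrow> K r = K' r"
    "(\<integral>\<^sup>+h. ennreal (K' (norm (h::'a::euclidean_space))) * ennreal (min (norm h powr p) 1) \<partial>lborel) < \<infinity>"
proof -
  obtain K1 where K1[measurable]: "K1 \<in> borel_measurable borel" "AE r in lborel. r \<in> {0..} \<longrightarrow> K r = K1 r"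
    by (rule borel_representative[OF _ K]) auto
  define K' where "K' r = max 0 (K1 r)" for r
  have [measurable]: "K' \<in> borel_measurable borel" unfolding K'_def[abs_def] by measurable
  have K'0: "0 \<le> K' r" for r by (simp add: K'_def)
  have ae: "AE r in lborel. 0 \<le> r \<longrightarrow> K r = K' r"
    using K1(2)
  proof eventually_elim
    case (elim r)
    then show ?case using K0[of r] by (auto simp: K'_def)
  qed
  let ?c = "unit_ball_vol (real DIM('a)) * real DIM('a)"
  have c0: "0 \<le> ?c" using unit_ball_vol_pos[of "real DIM('a)"] by simp
  have "(\<integral>\<^sup>+h. ennreal (K' (norm (h::'a))) * ennreal (min (norm h powr p) 1) \<partial>lborel) =
     (\<integral>\<^sup>+r. radial_density TYPE('a) r * (ennreal (K' r) * ennreal (min (r powr p) 1)) \<partial>lborel)"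
    by (rule nn_integral_radial) simp
  also have "\<dots> = (\<integral>\<^sup>+r. ennreal ?c * (ennreal (min (r powr p) 1 * K' r * r ^ (DIM('a) - 1)) * indicator {0..} r) \<partial>lborel)"
    using c0 K'0
    by (intro nn_integral_cong)
      (auto simp: radial_density_def indicator_def mult_ac simp flip: ennreal_mult)
  also have "\<dots> = ennreal ?c * (\<integral>\<^sup>+r. ennreal (min (r powr p) 1 * K' r * r ^ (DIM('a) - 1)) * indicator {0..} r \<partial>lborel)"
    by (rule nn_integral_cmult) simp
  also have "(\<integral>\<^sup>+r. ennreal (min (r powr p) 1 * K' r * r ^ (DIM('a) - 1)) * indicator {0..} r \<partial>lborel) =
     (\<integral>\<^sup>+r. ennreal (min (r powr p) 1 * K r * r ^ (DIM('a) - 1)) * indicator {0..} r \<partial>lborel)"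
    by (rule nn_integral_cong_AE) (use ae in \<open>auto elim!: eventually_mono simp: indicator_def\<close>)
  also have "ennreal ?c * \<dots> < \<infinity>"
    using fin by (subst (asm) nn_integral_lebesgue_on) (auto simp: ennreal_mult_less_top)
  finally show ?thesis using that[of K'] K'0 ae by simp
qed

section \<open>Powers of norms\<close>

lemma ennreal_powr_inverse: "0 < p \<Longrightarrow> ennreal_powr (ennreal_powr x (1 / p)) p = x"
  by (cases x) (auto simp: ennreal_powr_def powr_powr)

lemma ennreal_powr_less_top_iff: "ennreal_powr x a < \<infinity> \<longleftrightarrow> x < \<infinity>"
  by (auto simp: ennreal_powr_def less_top)

lemma ennreal_powr_le:
  assumes "x \<le> ennreal d" "0 \<le> d" "0 \<le> a"
  shows "ennreal_powr x a \<le> ennreal (d powr a)"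
proof -
  have "x \<noteq> \<infinity>" using assms(1) by (auto simp: top_unique)
  moreover have "enn2real x \<le> d" using assms by (simp add: enn2real_leI)
  ultimately show ?thesis
    using assms by (simp add: ennreal_powr_def ennreal_leI powr_mono2)
qed

lemma energy_add_finite:
  fixes u v :: "'a::euclidean_space \<Rightarrow> real"
  assumes [measurable]: "u \<in> borel_measurable borel" "v \<in> borel_measurable borel" "k \<in> borel_measurable borel"
    "A \<in> sets borel" and "0 \<le> p" "energy p k A u < \<infinity>" "energy p k A v < \<infinity>"
  shows "energy p k A (\<lambda>x. u x + v x) < \<infinity>"
proof -
  let ?I = "\<lambda>u h. \<integral>\<^sup>+x. ennreal (\<bar>u (x + h) - u x\<bar> powr p) * indicator A x * indicator A (x + h) \<partial>lborel"
  have "?I (\<lambda>x. u x + v x) h \<le> ennreal (3 powr p) * (?I u h + ?I v h)" for h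
  proof -
    have "ennreal (\<bar>u (x + h) + v (x + h) - (u x + v x)\<bar> powr p) \<le> ennreal (3 powr p) *
      (ennreal (\<bar>u (x + h) - u x\<bar> powr p) + ennreal (\<bar>v (x + h) - v x\<bar> powr p))" for x
      using ennreal_powr_sum3_le[of "u (x + h) + v (x + h) - (u x + v x)" "u (x + h) - u x" "v (x + h) - v x" 0 p]
        assms(5) by simp
    then have "?I (\<lambda>x. u x + v x) h \<le> (\<integral>\<^sup>+x. ennreal (3 powr p) *
      (ennreal (\<bar>u (x + h) - u x\<bar> powr p) * indicator A x * indicator A (x + h) +
       ennreal (\<bar>v (x + h) - v x\<bar> powr p) * indicator A x * indicator A (x + h)) \<partial>lborel)"
      by (intro nn_integral_mono) (auto simp: indicator_def)
    also have "\<dots> = ennreal (3 powr p) * (?I u h + ?I v h)"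
      by (simp add: nn_integral_cmult nn_integral_add)
    finally show ?thesis .
  qed
  then have "energy p k A (\<lambda>x. u x + v x) \<le>
     (\<integral>\<^sup>+h. ennreal (k h) * (ennreal (3 powr p) * (?I u h + ?I v h)) \<partial>lborel)"
    unfolding energy_def by (intro nn_integral_mono mult_left_mono) auto
  also have "\<dots> = (\<integral>\<^sup>+h. ennreal (3 powr p) * (ennreal (k h) * ?I u h + ennreal (k h) * ?I v h) \<partial>lborel)"
    by (intro nn_integral_cong) (simp add: distrib_left mult_ac)
  also have "\<dots> = ennreal (3 powr p) * (energy p k A u + energy p k A v)"
    unfolding energy_def by (simp add: nn_integral_cmult nn_integral_add)
  also have "\<dots> < \<infinity>" using assms by (simp add: ennreal_mult_less_top)
  finally show ?thesis .
qed

section \<open>Density of smooth functions\<close>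

theorem theorem15:
  fixes p :: real and \<Omega> :: "'a::euclidean_space set" and K :: "real \<Rightarrow> real"
  assumes "1 \<le> p"
    and "open \<Omega>"
    and "\<And>x. 0 \<le> x \<Longrightarrow> 0 \<le> K x"
    and "K \<in> borel_measurable (lebesgue_on {0..})"
    and "(\<integral>\<^sup>+x. ennreal (min (x powr p) 1 * K x * x ^ (DIM('a) - 1)) \<partial>lebesgue_on {0..}) < \<infinity>"
  shows "dense_wrt_norm (X_norm p K \<Omega>) (C_infinity \<Omega> \<inter> X_space p K \<Omega>) (X_space p K \<Omega>)"
proof -
  obtain K' where [measurable]: "K' \<in> borel_measurable borel"
    and K'0: "\<And>r. 0 \<le> K' r" and K': "AE r in lborel. 0 \<le> r \<longrightarrow> K r = K' r"
    and fin: "(\<integral>\<^sup>+h. ennreal (K' (norm (h::'a))) * ennreal (min (norm h powr p) 1) \<partial>lborel) < \<infinity>"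
    by (rule kernel_representative[OF assms(1) assms(3) assms(4,5)]) (assumption | rule that)+
  define k where "k = (\<lambda>h::'a. K' (norm h))"
  have k_meas[measurable]: "k \<in> borel_measurable borel" unfolding k_def by measurable
  have k_fin: "(\<integral>\<^sup>+h. ennreal (k h) * ennreal (min (norm h powr p) 1) \<partial>lborel) < \<infinity>"
    using fin by (simp add: k_def)
  have \<Omega>_borel[measurable]: "\<Omega> \<in> sets borel" using assms(2) by simp
  have p0: "0 < p" using assms(1) by simp
  have K_eq: "K_seminorm p K \<Omega> u = ennreal_powr (energy p k \<Omega> U) (1 / p)"
    if "U \<in> borel_measurable borel" "AE x in lborel. x \<in> \<Omega> \<longrightarrow> u x = U x" for u U :: "'a \<Rightarrow> real"
    unfolding K_seminorm_def k_def
    using double_integral_eq_energy[OF \<Omega>_borel that(1) \<open>K' \<in> borel_measurable borel\<close> that(2) K' K'0] by simp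
  show ?thesis
    unfolding dense_wrt_norm_def
  proof (intro conjI ballI allI impI)
    show "C_infinity \<Omega> \<inter> X_space p K \<Omega> \<subseteq> X_space p K \<Omega>" by simp
    fix f :: "'a \<Rightarrow> real" and \<epsilon> :: real
    assume f: "f \<in> X_space p K \<Omega>" and \<epsilon>: "0 < \<epsilon>"
    have "f \<in> borel_measurable (lebesgue_on \<Omega>)" using f by (simp add: X_space_def Lp_space_def)
    from borel_representative[OF \<Omega>_borel this] obtain F
      where F[measurable]: "F \<in> borel_measurable borel" and F0: "\<And>x. x \<notin> \<Omega> \<Longrightarrow> F x = 0"
        and fF: "AE x in lborel. x \<in> \<Omega> \<longrightarrow> f x = F x" by blast
    have LF: "Lp_pow p F < \<infinity>"
      using f Lp_integral_eq_Lp_pow[OF \<Omega>_borel fF F0, of p] by (simp add: X_space_def Lp_space_def)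
    have EF: "energy p k \<Omega> F < \<infinity>"
      using f K_eq[OF F fF] by (simp add: X_space_def ennreal_powr_less_top_iff[simplified])
    (* Half of \<epsilon>, since the approximation only gives a non-strict bound. *)
    define d where "d = (\<epsilon> / 2) powr p"
    have d: "0 < d" using \<epsilon> by (simp add: d_def)
    obtain G where G_smooth: "\<And>j. Ck_on j G \<Omega>" and G[measurable]: "G \<in> borel_measurable borel"
      and G0: "\<And>x. x \<notin> \<Omega> \<Longrightarrow> G x = 0"
      and FG: "Lp_pow p (\<lambda>x. G x - F x) + energy p k \<Omega> (\<lambda>x. G x - F x) \<le> ennreal d"
      by (rule smooth_approximation[OF assms(1,2) F k_meas k_fin F0 LF EF d]) (assumption | rule that)+
    have "Lp_pow p (\<lambda>x. G x - F x) + energy p k \<Omega> (\<lambda>x. G x - F x) < \<infinity>"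
      using FG by (rule le_less_trans) simp
    then have LD: "Lp_pow p (\<lambda>x. G x - F x) < \<infinity>" and ED: "energy p k \<Omega> (\<lambda>x. G x - F x) < \<infinity>"
      by simp_all
    have AEG: "AE x in lborel. x \<in> \<Omega> \<longrightarrow> G x = G x" by simp
    have "Lp_pow p G \<le> ennreal (3 powr p) * (Lp_pow p F + Lp_pow p (\<lambda>x. G x - F x) + Lp_pow p (\<lambda>x::'a. 0))"
      by (rule Lp_pow_sum3_le) (use p0 in auto)
    also have "\<dots> < \<infinity>" using LF LD by (simp add: ennreal_mult_less_top Lp_pow_def)
    finally have LG: "Lp_pow p G < \<infinity>" .
    have "energy p k \<Omega> (\<lambda>x. F x + (G x - F x)) < \<infinity>"
      by (rule energy_add_finite) (use p0 EF ED in auto)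
    then have EG: "energy p k \<Omega> G < \<infinity>" by simp
    have "G \<in> borel_measurable (lebesgue_on \<Omega>)"
      using G by (intro measurable_restrict_space1 measurable_completion) simp
    then have "G \<in> X_space p K \<Omega>"
      using LG EG Lp_integral_eq_Lp_pow[OF \<Omega>_borel AEG G0, of p] K_eq[OF G AEG]
      by (simp add: X_space_def Lp_space_def ennreal_powr_less_top_iff[simplified])
    moreover have "G \<in> C_infinity \<Omega>" using G_smooth by (simp add: C_infinity_def)
    moreover have "X_norm p K \<Omega> (\<lambda>x. f x - G x) < ennreal \<epsilon>"
    proof -
      have ae: "AE x in lborel. x \<in> \<Omega> \<longrightarrow> f x - G x = F x - G x"
        using fF by eventually_elim simp
      have "Lp_integral p \<Omega> (\<lambda>x. f x - G x) = Lp_pow p (\<lambda>x. F x - G x)"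
        by (rule Lp_integral_eq_Lp_pow[OF \<Omega>_borel ae]) (simp add: F0 G0)
      also have "\<dots> = Lp_pow p (\<lambda>x. G x - F x)"
        by (simp add: Lp_pow_def abs_minus_commute)
      finally have 1: "Lp_integral p \<Omega> (\<lambda>x. f x - G x) = Lp_pow p (\<lambda>x. G x - F x)" .
      have "\<bar>F (x + h) - G (x + h) - (F x - G x)\<bar> = \<bar>G (x + h) - F (x + h) - (G x - F x)\<bar>" for x h
        by linarith
      then have "energy p k \<Omega> (\<lambda>x. F x - G x) = energy p k \<Omega> (\<lambda>x. G x - F x)"
        unfolding energy_def by simp
      moreover have "K_seminorm p K \<Omega> (\<lambda>x. f x - G x) = ennreal_powr (energy p k \<Omega> (\<lambda>x. F x - G x)) (1 / p)"
        by (rule K_eq[OF _ ae]) simp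
      ultimately have "X_norm p K \<Omega> (\<lambda>x. f x - G x) =
         ennreal_powr (Lp_pow p (\<lambda>x. G x - F x) + energy p k \<Omega> (\<lambda>x. G x - F x)) (1 / p)"
        by (simp add: X_norm_def 1 ennreal_powr_inverse[OF p0])
      also have "\<dots> \<le> ennreal (d powr (1 / p))"
        by (rule ennreal_powr_le[OF FG]) (use d p0 in auto)
      also have "d powr (1 / p) = \<epsilon> / 2" using \<epsilon> p0 by (simp add: d_def powr_powr)
      also have "ennreal (\<epsilon> / 2) < ennreal \<epsilon>" using \<epsilon> by (simp add: ennreal_less_iff)
      finally show ?thesis .
    qed
    ultimately show "\<exists>g\<in>C_infinity \<Omega> \<inter> X_space p K \<Omega>. X_norm p K \<Omega> (\<lambda>x. f x - g x) < ennreal \<epsilon>" by blast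
  qed
qed

end
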